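(* Let $m,n\ge 1$ be integers, and let $\nu>m-1$, $\sigma>0$ and $\rho^2>0$ be real numbers. For $\mu\in\mathbb{R}^m$ and a symmetric positive definite $\Sigma\in\mathbb{R}^{m\times m}$ let $$f(x^n;\mu,\Sigma)=\frac{1}{(2\pi)^{mn/2}|\Sigma|^{n/2}}\exp\Big\{-\frac12\sum_{i=1}^n (x_i-\mu)^\top\Sigma^{-1}(x_i-\mu)\Big\},\qquad x^n=(x_1,\dots,x_n)\in(\mathbb{R}^m)^n,$$ and let the luckiness function be $$w(\mu,\Sigma)=\frac{1}{(2\pi)^{m\nu/2}|\Sigma|^{\nu/2}}\exp\Big[-\frac{\nu}{2}\operatorname{tr}\big\{\Sigma^{-1}(\sigma^2 I_m+\rho^2\mu\mu^\top)\big\}\Big].$$ Then the capacity of the model of $n$ independent observations from an $m$-dimensional normal distribution with luckiness $w$, namely $$C=\int_{(\mathbb{R}^m)^n}\ \max_{\mu\in\mathbb{R}^m,\ \Sigma>0} f(x^n;\mu,\Sigma)\,w(\mu,\Sigma)\,dx^n ,$$ equals $$C=\mathcal{C}(m,n,\nu,\sigma^2,\rho^2):=\frac{1}{\sigma^{m\nu}}\left(\frac{(n+\nu)^{n+\nu}\big(1+\frac{n}{\rho^2\nu}\big)}{(2e)^{n+\nu}(\pi\nu)^{\nu}}\right)^{m/2}\frac{\Gamma_m(\frac{\nu}{2})}{\Gamma_m(\frac{n+\nu}{2})}.$$ Correspondingly, the LNML density $\bar p_n(x^n)=\frac1C\max_{\mu\in\mathbb{R}^m,\Sigma>0}f(x^n;\mu,\Sigma)w(\mu,\Sigma)$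 is given, for every $x^n\in(\mathbb{R}^m)^n$, by $$\bar p_n(x^n)=\frac{f(x^n;\bar\mu_n,\bar\Sigma_n)\,w(\bar\mu_n,\bar\Sigma_n)}{\mathcal{C}(m,n,\nu,\sigma^2,\rho^2)}=\left(\frac{\nu^{\nu}}{\pi^n(n+\nu)^{n+\nu}\big(1+\frac{n}{\rho^2\nu}\big)}\right)^{m/2}\frac{\Gamma_m(\frac{n+\nu}{2})}{\Gamma_m(\frac{\nu}{2})}\,\frac{\sigma^{m\nu}}{|\bar\Sigma_n|^{\frac{n+\nu}{2}}},$$ where $$\bar\mu_n=\frac{1}{n+\rho^2\nu}\sum_{i=1}^n x_i,\qquad \bar\Sigma_n=\frac{1}{n+\nu}\Big(\sum_{i=1}^n x_ix_i^\top+\nu\sigma^2 I_m\Big)-\frac{1}{(\nu+n)(\rho^2\nu+n)}\sum_{i,j=1}^n x_ix_j^\top$$ are the maximum a-posteriori probability (MAP) estimates under the prior proportional to $w$, i.e. $(\bar\mu_n,\bar\Sigma_n)$ maximizes $(\mu,\Sigma)\mapsto f(x^n;\mu,\Sigma)w(\mu,\Sigma)$ over $\mu\in\mathbb{R}^m$, $\Sigma>0$.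
   Context: Here $\Sigma>0$ means that $\Sigma$ is a symmetric positive definite matrix, $|\cdot|$ of a matrix denotes its determinant, $I_m$ is the $m\times m$ identity matrix, $\pi$ is the usual constant, and $dx^n$ is Lebesgue measure on $(\mathbb{R}^m)^n$. The multivariate gamma function is $\Gamma_m(z)=\pi^{m(m-1)/4}\prod_{j=0}^{m-1}\Gamma(z-\frac j2)$. Normalized maximum likelihood with luckiness (LNML): given a parametric family of densities $f(x^n;\theta)$, $\theta\in\Theta$, and a luckiness function $w:\Theta\to(0,\infty)$, the capacity is $C=\int\max_{\theta\in\Theta}f(x^n;\theta)w(\theta)\,dx^n$ and the LNML density is $\bar p_n(x^n)=\max_{\theta\in\Theta}f(x^n;\theta)w(\theta)/C$. *)

theory Defs
  imports "HOL-Analysis.Analysis"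
begin

section \<open>Normalized maximum likelihood with luckiness\<close>

text \<open>
  The maximum of a real function over a possibly infinite parameter set. The value is
  unspecified if no maximum is attained.
\<close>

definition max_over :: "'p set \<Rightarrow> ('p \<Rightarrow> real) \<Rightarrow> real" where
  "max_over \<Theta> g = (GREATEST v. v \<in> g ` \<Theta>)"

text \<open>
  The capacity is a Bochner integral, hence \<open>0\<close> if the maximized likelihood is not integrable;
  integrability has to be stated separately where it matters.
\<close>

definition lnml_capacity ::
  "('x::euclidean_space \<Rightarrow> 'p \<Rightarrow> real) \<Rightarrow> 'p set \<Rightarrow> ('p \<Rightarrow> real) \<Rightarrow> real" where
  "lnml_capacity f \<Theta> w = (\<integral>x. max_over \<Theta> (\<lambda>\<theta>. f x \<theta> * w \<theta>) \<partial>lborel)"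

definition lnml_density ::
  "('x::euclidean_space \<Rightarrow> 'p \<Rightarrow> real) \<Rightarrow> 'p set \<Rightarrow> ('p \<Rightarrow> real) \<Rightarrow> 'x \<Rightarrow> real" where
  "lnml_density f \<Theta> w x = max_over \<Theta> (\<lambda>\<theta>. f x \<theta> * w \<theta>) / lnml_capacity f \<Theta> w"


section \<open>The multivariate normal model\<close>

definition pos_def :: "real^'m^'m \<Rightarrow> bool" where
  "pos_def A \<longleftrightarrow> transpose A = A \<and> (\<forall>v. v \<noteq> 0 \<longrightarrow> v \<bullet> (A *v v) > 0)"

definition outer :: "real^'m \<Rightarrow> real^'m \<Rightarrow> real^'m^'m" where
  "outer u v = (\<chi> i j. u $ i * v $ j)"

definition multi_Gamma :: "nat \<Rightarrow> real \<Rightarrow> real" where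
  "multi_Gamma m z =
     pi powr (real m * (real m - 1) / 4) * (\<Prod>j<m. Gamma (z - real j / 2))"

text \<open>
  A sample of size \<open>n = CARD('n)\<close> in dimension \<open>m = CARD('m)\<close> is \<open>x :: real^'m^'n\<close>, with
  \<open>i\<close>-th observation \<open>x $ i :: real^'m\<close>. Parameters are pairs \<open>(\<mu>, \<Sigma>)\<close>. All powers with a real
  exponent have a positive base (for \<open>det \<Sigma>\<close>, on the parameter set below).
\<close>

definition normal_params :: "((real^'m) \<times> (real^'m^'m)) set" where
  "normal_params = UNIV \<times> {\<Sigma>. pos_def \<Sigma>}"

definition normal_lik :: "real^'m^'n \<Rightarrow> (real^'m) \<times> (real^'m^'m) \<Rightarrow> real" where
  "normal_lik x = (\<lambda>(\<mu>, \<Sigma>).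
     1 / ((2 * pi) powr (real CARD('m) * real CARD('n) / 2) * det \<Sigma> powr (real CARD('n) / 2)) *
     exp (- (1 / 2) * (\<Sum>i\<in>UNIV. (x $ i - \<mu>) \<bullet> (matrix_inv \<Sigma> *v (x $ i - \<mu>)))))"

definition luckiness :: "real \<Rightarrow> real \<Rightarrow> real \<Rightarrow> (real^'m) \<times> (real^'m^'m) \<Rightarrow> real" where
  "luckiness \<nu> \<sigma> \<rho> = (\<lambda>(\<mu>, \<Sigma>).
     1 / ((2 * pi) powr (real CARD('m) * \<nu> / 2) * det \<Sigma> powr (\<nu> / 2)) *
     exp (- (\<nu> / 2) * trace (matrix_inv \<Sigma> ** (\<sigma>\<^sup>2 *\<^sub>R mat 1 + \<rho>\<^sup>2 *\<^sub>R outer \<mu> \<mu>))))"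

definition mean_est :: "real \<Rightarrow> real \<Rightarrow> real^'m^'n \<Rightarrow> real^'m" where
  "mean_est \<nu> \<rho> x = (1 / (real CARD('n) + \<rho>\<^sup>2 * \<nu>)) *\<^sub>R (\<Sum>i\<in>UNIV. x $ i)"

definition cov_est :: "real \<Rightarrow> real \<Rightarrow> real \<Rightarrow> real^'m^'n \<Rightarrow> real^'m^'m" where
  "cov_est \<nu> \<sigma> \<rho> x =
     (1 / (real CARD('n) + \<nu>)) *\<^sub>R
       ((\<Sum>i\<in>UNIV. outer (x $ i) (x $ i)) + (\<nu> * \<sigma>\<^sup>2) *\<^sub>R mat 1)
     - (1 / ((\<nu> + real CARD('n)) * (\<rho>\<^sup>2 * \<nu> + real CARD('n)))) *\<^sub>R
       (\<Sum>i\<in>UNIV. \<Sum>j\<in>UNIV. outer (x $ i) (x $ j))"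

text \<open>The arguments \<open>s\<close> and \<open>r\<close> stand for \<open>\<sigma>\<^sup>2\<close> and \<open>\<rho>\<^sup>2\<close>, so \<open>sqrt s\<close> is \<open>\<sigma>\<close>.\<close>

definition normal_capacity :: "nat \<Rightarrow> nat \<Rightarrow> real \<Rightarrow> real \<Rightarrow> real \<Rightarrow> real" where
  "normal_capacity m n \<nu> s r =
     1 / sqrt s powr (real m * \<nu>) *
     (((real n + \<nu>) powr (real n + \<nu>) * (1 + real n / (r * \<nu>))) /
      ((2 * exp 1) powr (real n + \<nu>) * (pi * \<nu>) powr \<nu>)) powr (real m / 2) *
     (multi_Gamma m (\<nu> / 2) / multi_Gamma m ((real n + \<nu>) / 2))"

end

theory Submission
  imports Defs "HOL-Probability.Distributions"
begin

text \<open>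
  \<^bold>\<open>Maximization.\<close> Write \<open>N = n + \<nu>\<close> and \<open>d = \<rho>\<^sup>2 \<nu>\<close>. The exponents of likelihood and luckiness
  combine to \<open>-1/2\<close> times the trace of \<open>\<Sigma>\<^sup>-\<^sup>1\<close> against a scatter matrix, and completing the square
  in \<open>\<mu>\<close> turns that matrix into \<open>N\<close> times the covariance estimate plus \<open>n + d\<close> times the outer
  square of \<open>\<mu>\<close> minus the mean estimate (\<open>likelihood_times_luckiness\<close>). The second part is
  nonnegative against \<open>\<Sigma>\<^sup>-\<^sup>1\<close>, so the best \<open>\<mu>\<close> is the mean estimate. For the covariance what is needed
  is \<open>det T \<le> exp (tr T - m)\<close> for positive definite \<open>T\<close>, which is \<open>t \<le> exp (t - 1)\<close> for each eigenvalue;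
  the spectral theorem for symmetric matrices supplies the eigenvalues. The maximum is therefore a
  constant times \<open>det (cov_est x)\<close> to the power \<open>-N/2\<close>.

  \<^bold>\<open>Integration.\<close> Up to the factor \<open>1/N\<close>, the covariance estimate is \<open>\<nu> \<sigma>\<^sup>2\<close> times the identity
  plus the shrunken scatter matrix \<open>\<Sum>x\<^sub>i x\<^sub>i\<^sup>T - s s\<^sup>T / (d + n)\<close>, where \<open>s = \<Sum>x\<^sub>i\<close>. The observations are
  integrated out one at a time. As a function of one \<open>x\<^sub>i\<close> the matrix is
  \<open>B + g (x\<^sub>i - v) (x\<^sub>i - v)\<^sup>T\<close>, where \<open>B\<close> has the same form for the other \<open>n - 1\<close> observations, with the
  same \<open>d\<close> (\<open>shrunken_scatter_insert\<close>). Since \<open>det (B + u u\<^sup>T) = det B (1 + u\<^sup>T B\<^sup>-\<^sup>1 u)\<close>, integrating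
  \<open>det\<^sup>-\<^sup>a\<close> over \<open>x\<^sub>i\<close> leaves a constant times \<open>det B\<close> to the power \<open>-(a - 1/2)\<close>
  (\<open>nn_integral_det_rank_one_update\<close>), and the induction closes. The factors \<open>1/g = (d + k + 1) / (d + k)\<close>
  multiply up to \<open>1 + n/d\<close>, and the Gamma quotients
  \<open>\<Gamma>(a - m/2) / \<Gamma>(a)\<close> for \<open>a = N/2, (N - 1)/2, \<dots>\<close> telescope to the quotient of multivariate Gamma functions
  (\<open>prod_student_integral\<close>). The condition \<open>\<nu> > m - 1\<close> is exactly convergence of the last of
  these integrals, the one with \<open>a = (\<nu> + 1)/2\<close>.

  The linear substitutions rest on invariance of Lebesgue measure under orthogonal maps, which follows
  from translation invariance and Fubini alone (\<open>nn_integral_orthogonal_transformation\<close>).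
\<close>

section \<open>Symmetric and positive definite matrices\<close>

definition diagonal :: "('m::finite \<Rightarrow> real) \<Rightarrow> real^'m^'m" where
  "diagonal d = (\<chi> i j. if i = j then d i else 0)"

lemma diagonal_vector: "diagonal d *v x = (\<chi> i. d i * x $ i)"
  by (simp add: diagonal_def matrix_vector_mult_def vec_eq_iff if_distrib[where f="\<lambda>t. t * _"] cong: if_cong)

lemma diagonal_mult: "diagonal d ** diagonal e = diagonal (\<lambda>i. d i * e i)"
  by (simp add: diagonal_def matrix_matrix_mult_def vec_eq_iff if_distrib[where f="\<lambda>t. t * _"] cong: if_cong)

lemma transpose_diagonal [simp]: "transpose (diagonal d) = diagonal d"
  by (auto simp: diagonal_def transpose_def vec_eq_iff)

lemma det_diagonal_matrix: "det (diagonal d) = (\<Prod>i\<in>UNIV. d i)"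
  by (subst det_diagonal) (auto simp: diagonal_def)

lemma trace_diagonal: "trace (diagonal d) = (\<Sum>i\<in>UNIV. d i)"
  by (simp add: trace_def diagonal_def)

lemma inner_matrix_vector: "x \<bullet> (A *v y) = (transpose A *v x) \<bullet> (y :: real^'m)"
  for A :: "real^'m^'k"
  by (simp add: dot_lmul_matrix)

lemma matrix_add_rdistrib: "(A + B) ** C = A ** C + B ** (C :: real^'k^'m)"
  by (simp add: matrix_matrix_mult_def vec_eq_iff algebra_simps sum.distrib)

lemma matrix_mult_scaleR: "A ** (c *\<^sub>R B) = c *\<^sub>R (A ** B)" for A B :: "real^'m^'m"
  by (simp add: matrix_matrix_mult_def vec_eq_iff sum_distrib_left mult_ac)

lemma trace_scaleR: "trace (c *\<^sub>R A) = c * trace A" for A :: "real^'m^'m"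
  by (simp add: trace_def sum_distrib_left)

lemma det_scaleR: "det (c *\<^sub>R A) = c ^ CARD('m) * det A" for A :: "real^'m^'m"
proof -
  have "c *\<^sub>R A = diagonal (\<lambda>_. c) ** A"
    by (simp add: diagonal_def matrix_matrix_mult_def vec_eq_iff if_distrib[where f="\<lambda>t. t * _"] cong: if_cong)
  then show ?thesis by (simp add: det_mul det_diagonal_matrix)
qed

lemma matrix_inv_inverse:
  fixes A :: "real^'m^'m"
  assumes "det A \<noteq> 0"
  shows "A ** matrix_inv A = mat 1" "matrix_inv A ** A = mat 1"
proof -
  have "\<exists>A'. A ** A' = mat 1 \<and> A' ** A = mat 1"
    using assms by (simp add: invertible_det_nz[symmetric] invertible_def)
  then have "A ** matrix_inv A = mat 1 \<and> matrix_inv A ** A = mat 1"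
    unfolding matrix_inv_def by (rule someI_ex)
  then show "A ** matrix_inv A = mat 1" "matrix_inv A ** A = mat 1" by auto
qed

text \<open>
  The orthogonal complement \<open>W\<close> of a set of eigenvectors is invariant under the symmetric map \<open>A\<close>,
  and a maximizer \<open>v\<close> of the Rayleigh quotient on the unit sphere of \<open>W\<close> is an eigenvector: the form
  \<open>c |u|\<^sup>2 - u \<bullet> A u\<close> is nonnegative on \<open>W\<close> and vanishes at \<open>v\<close>, so its derivative at \<open>v\<close> in the
  direction \<open>A v - c v \<in> W\<close> vanishes too.
\<close>

lemma eigenvector_orthogonal_to_eigenvectors:
  fixes A :: "real^'m^'m"
  assumes sym: "transpose A = A"
    and eig: "\<And>s. s \<in> S \<Longrightarrow> \<exists>c. A *v s = c *\<^sub>R s"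
    and dim: "dim S < CARD('m)"
  obtains v c where "norm v = 1" "A *v v = c *\<^sub>R v" "\<And>s. s \<in> S \<Longrightarrow> orthogonal s v"
proof -
  define W where "W = {u. \<forall>s\<in>S. s \<bullet> u = 0}"
  have W_add: "u + w \<in> W" if "u \<in> W" "w \<in> W" for u w
    using that by (auto simp: W_def inner_add_right)
  have W_scale: "t *\<^sub>R u \<in> W" if "u \<in> W" for t u
    using that by (auto simp: W_def)
  have W_A: "A *v u \<in> W" if "u \<in> W" for u
    unfolding W_def
  proof safe
    fix s assume "s \<in> S"
    then obtain c where "A *v s = c *\<^sub>R s" using eig by blast
    then show "s \<bullet> (A *v u) = 0"
      using that \<open>s \<in> S\<close> inner_matrix_vector[of s A u] sym by (simp add: W_def del: transpose_matrix_vector)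
  qed
  obtain x where x: "x \<noteq> 0" "x \<in> W"
  proof -
    have "dim S < DIM(real^'m)" using dim by simp
    then obtain x where "x \<noteq> 0" "\<And>y. y \<in> span S \<Longrightarrow> orthogonal x y"
      using orthogonal_to_subspace_exists by blast
    then show ?thesis
      using that[of x] by (auto simp: W_def orthogonal_def inner_commute span_base)
  qed
  have W_closed: "closed W"
  proof -
    have "W = (\<Inter>s\<in>S. {u. s \<bullet> u = 0})" by (auto simp: W_def)
    then show ?thesis by (auto intro!: closed_INT closed_hyperplane)
  qed
  have comp: "compact (W \<inter> sphere 0 1)"
    using W_closed by (simp add: closed_Int_compact)
  have "(1 / norm x) *\<^sub>R x \<in> W \<inter> sphere 0 1"
    using x W_scale by auto
  then have ne: "W \<inter> sphere 0 1 \<noteq> {}" by blast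
  have "continuous_on (W \<inter> sphere 0 1) (\<lambda>u. u \<bullet> (A *v u))"
    by (intro continuous_intros linear_continuous_on bounded_linear.continuous_on[OF matrix_vector_mul_bounded_linear])
  from continuous_attains_sup[OF comp ne this]
  obtain v where v: "v \<in> W" "norm v = 1"
    and vmax: "\<And>u. u \<in> W \<Longrightarrow> norm u = 1 \<Longrightarrow> u \<bullet> (A *v u) \<le> v \<bullet> (A *v v)"
    by auto
  define c where "c = v \<bullet> (A *v v)"
  define q where "q u = c * (u \<bullet> u) - u \<bullet> (A *v u)" for u
  have q_nonneg: "q u \<ge> 0" if "u \<in> W" for u
  proof (cases "u = 0")
    case False
    have "norm ((1 / norm u) *\<^sub>R u) = 1" using False by simp
    with vmax[of "(1 / norm u) *\<^sub>R u"] W_scale[OF that]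
    have "(1 / norm u) * ((1 / norm u) * (u \<bullet> (A *v u))) \<le> c"
      by (simp add: c_def matrix_vector_mult_scaleR)
    then have "u \<bullet> (A *v u) \<le> c * (norm u)\<^sup>2"
      using False by (simp add: field_simps power2_eq_square)
    then show ?thesis by (simp add: q_def power2_norm_eq_inner)
  qed (simp add: q_def)
  define z where "z = A *v v - c *\<^sub>R v"
  have zW: "z \<in> W"
    unfolding z_def using W_add[OF W_A[OF v(1)] W_scale[OF v(1), of "-c"]] by simp
  have expand: "q (v + t *\<^sub>R z) = t\<^sup>2 * q z - 2 * t * (z \<bullet> z)" for t
  proof -
    have vv: "v \<bullet> v = 1" using v(2) by (simp add: norm_eq_1)
    have vz: "v \<bullet> (A *v z) = (A *v v) \<bullet> z"
      using inner_matrix_vector[of v A z] sym by (simp del: transpose_matrix_vector)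
    have Avz: "(A *v v) \<bullet> z = z \<bullet> z + c * (v \<bullet> z)"
    proof -
      have "A *v v = z + c *\<^sub>R v" by (simp add: z_def)
      then show ?thesis by (metis inner_add_left inner_scaleR_left)
    qed
    have vAv: "v \<bullet> (A *v v) = c" by (simp add: c_def)
    show ?thesis
      unfolding q_def
      by (simp add: matrix_vector_right_distrib matrix_vector_mult_scaleR inner_add_left inner_add_right
          vv vz vAv Avz inner_commute[of z v] inner_commute[of z "A *v v"] algebra_simps power2_eq_square)
  qed
  have "z \<bullet> z = 0"
  proof (rule ccontr)
    assume "z \<bullet> z \<noteq> 0"
    then have zz: "z \<bullet> z > 0" by (simp add: order_less_le)
    have "q z \<ge> 0" using q_nonneg zW by blast
    \<comment> \<open>a step short enough for the linear term to dominate; the \<open>+ 1\<close> covers \<open>q z = 0\<close>\<close>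
    define t where "t = (z \<bullet> z) / (q z + 1)"
    have t: "t > 0" "t * q z \<le> z \<bullet> z"
      using zz \<open>q z \<ge> 0\<close> by (auto simp: t_def field_simps)
    have "q (v + t *\<^sub>R z) \<ge> 0" using q_nonneg W_add v(1) W_scale zW by blast
    then have "t * (t * q z - 2 * (z \<bullet> z)) \<ge> 0"
      by (simp add: expand power2_eq_square algebra_simps)
    then have "t * q z - 2 * (z \<bullet> z) \<ge> 0" using t by (simp add: zero_le_mult_iff)
    then show False using t zz by linarith
  qed
  then have "A *v v = c *\<^sub>R v" by (simp add: z_def)
  with v that[of v c] show ?thesis by (auto simp: W_def orthogonal_def)
qed

lemma orthonormal_eigenvectors_exist:
  fixes A :: "real^'m^'m"
  assumes sym: "transpose A = A" and "k \<le> CARD('m)"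
  shows "\<exists>S. finite S \<and> card S = k \<and> pairwise orthogonal S \<and>
    (\<forall>v\<in>S. norm v = 1 \<and> (\<exists>c. A *v v = c *\<^sub>R v))"
  using assms(2)
proof (induction k)
  case 0
  show ?case by (intro exI[of _ "{}"]) auto
next
  case (Suc k)
  then obtain S where S: "finite S" "card S = k" "pairwise orthogonal S"
    "\<forall>v\<in>S. norm v = 1 \<and> (\<exists>c. A *v v = c *\<^sub>R v)" by auto
  have "dim S < CARD('m)" using dim_le_card'[OF S(1)] S(2) Suc.prems by simp
  with S(4) sym obtain v c where v: "norm v = 1" "A *v v = c *\<^sub>R v" "\<And>s. s \<in> S \<Longrightarrow> orthogonal s v"
    by (metis eigenvector_orthogonal_to_eigenvectors)
  have "v \<notin> S" using v(1,3) by (auto simp: orthogonal_def norm_eq_1)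
  moreover have "pairwise orthogonal (insert v S)"
    using S(3) v(3) by (auto simp: pairwise_insert orthogonal_commute)
  ultimately show ?case using S v by (intro exI[of _ "insert v S"]) auto
qed

theorem symmetric_matrix_diagonalization:
  fixes A :: "real^'m^'m"
  assumes sym: "transpose A = A"
  obtains Q d where "orthogonal_matrix Q" "A = Q ** diagonal d ** transpose Q"
proof -
  obtain S where S: "finite S" "card S = CARD('m)" "pairwise orthogonal S"
    "\<forall>v\<in>S. norm v = 1 \<and> (\<exists>c. A *v v = c *\<^sub>R v)"
    using orthonormal_eigenvectors_exist[OF sym order_refl] by blast
  obtain h where h: "bij_betw h (UNIV :: 'm set) S"
    using finite_same_card_bij[of "UNIV :: 'm set" S] S by auto
  then have hS: "h i \<in> S" for i by (auto simp: bij_betw_def)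
  then have "\<forall>i. \<exists>c. A *v h i = c *\<^sub>R h i" using S by blast
  then obtain d where d: "\<And>i. A *v h i = d i *\<^sub>R h i" by metis
  define Q :: "real^'m^'m" where "Q = (\<chi> i j. h j $ i)"
  have col: "column j Q = h j" for j by (simp add: column_def Q_def vec_eq_iff)
  have orth: "orthogonal_matrix Q"
    unfolding orthogonal_matrix_orthonormal_columns col
  proof safe
    fix i j :: 'm assume "i \<noteq> j"
    then have "h i \<noteq> h j" using h by (auto simp: bij_betw_def inj_on_def)
    then show "orthogonal (h i) (h j)" using S(3) hS by (auto simp: pairwise_def)
  qed (use S hS in auto)
  have "A ** Q = Q ** diagonal d"
  proof -
    have "(A ** Q) $ i $ j = (Q ** diagonal d) $ i $ j" for i j
    proof -
      have "(A ** Q) $ i $ j = (A *v h j) $ i"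
        by (simp add: matrix_matrix_mult_def matrix_vector_mult_def Q_def)
      also have "\<dots> = (Q ** diagonal d) $ i $ j"
        by (simp add: d matrix_matrix_mult_def Q_def diagonal_def if_distrib[where f="\<lambda>t. _ * t"] cong: if_cong)
      finally show ?thesis .
    qed
    then show ?thesis by (simp add: vec_eq_iff)
  qed
  then have "A ** Q ** transpose Q = Q ** diagonal d ** transpose Q" by simp
  then have "A = Q ** diagonal d ** transpose Q"
    using orth by (simp add: orthogonal_matrix_def matrix_mul_assoc[symmetric])
  with orth that show ?thesis by blast
qed

lemma pos_def_diagonalization:
  fixes A :: "real^'m^'m"
  assumes "pos_def A"
  obtains Q d where "orthogonal_matrix Q" "\<And>i. d i > 0" "A = Q ** diagonal d ** transpose Q"
proof -
  obtain Q d where Q: "orthogonal_matrix Q" and A: "A = Q ** diagonal d ** transpose Q"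
    using symmetric_matrix_diagonalization assms unfolding pos_def_def by metis
  have "d i > 0" for i
  proof -
    define v where "v = Q *v axis i 1"
    have Qv: "transpose Q *v v = axis i 1"
      using Q by (simp add: v_def matrix_vector_mul_assoc orthogonal_matrix_def del: transpose_matrix_vector)
    then have "v \<noteq> 0" by (auto simp: axis_eq_0_iff simp del: transpose_matrix_vector)
    then have "0 < v \<bullet> (A *v v)" using assms by (simp add: pos_def_def)
    also have "v \<bullet> (A *v v) = v \<bullet> (Q *v (diagonal d *v (transpose Q *v v)))"
      by (simp add: A matrix_vector_mul_assoc matrix_mul_assoc del: transpose_matrix_vector)
    also have "\<dots> = (transpose Q *v v) \<bullet> (diagonal d *v (transpose Q *v v))"
      by (rule inner_matrix_vector)
    also have "\<dots> = d i"
      unfolding Qv by (simp add: diagonal_vector inner_axis')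
    finally show ?thesis .
  qed
  with Q A that show ?thesis by blast
qed

text \<open>
  A square root of each eigenvalue gives a square root \<open>P\<close> of \<open>A\<close> in the weak sense \<open>A = P P\<^sup>T\<close>. This is
  all that the substitutions and congruences below need.
\<close>

lemma pos_def_factorization:
  fixes A :: "real^'m^'m"
  assumes "pos_def A"
  obtains P where "det P \<noteq> 0" "A = P ** transpose P"
proof -
  obtain Q d where Q: "orthogonal_matrix Q" "\<And>i. d i > 0" and A: "A = Q ** diagonal d ** transpose Q"
    using pos_def_diagonalization[OF assms] by metis
  define P where "P = Q ** diagonal (\<lambda>i. sqrt (d i))"
  have "diagonal d = diagonal (\<lambda>i. sqrt (d i)) ** diagonal (\<lambda>i. sqrt (d i))"
    using Q(2) by (simp add: diagonal_mult less_imp_le)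
  then have "A = P ** transpose P"
    by (simp add: A P_def matrix_transpose_mul matrix_mul_assoc)
  moreover have "det P \<noteq> 0"
    using det_orthogonal_matrix[OF Q(1)] Q(2)
    by (auto simp: P_def det_mul det_diagonal_matrix prod_zero_iff less_le)
  ultimately show ?thesis using that by blast
qed

lemma pos_def_det_pos: "pos_def A \<Longrightarrow> det A > 0"
  by (erule pos_def_factorization) (auto simp: det_mul simp flip: power2_eq_square)

lemma pos_def_congruence:
  fixes A R :: "real^'m^'m"
  assumes A: "pos_def A" and R: "det R \<noteq> 0"
  shows "pos_def (R ** A ** transpose R)"
  unfolding pos_def_def
proof safe
  show "transpose (R ** A ** transpose R) = R ** A ** transpose R"
    using A by (simp add: pos_def_def matrix_transpose_mul matrix_mul_assoc)
  fix v :: "real^'m" assume "v \<noteq> 0"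
  have "transpose R *v v \<noteq> 0"
  proof
    assume "transpose R *v v = 0"
    moreover have "invertible (transpose R)" using R by (simp add: invertible_det_nz)
    ultimately show False using \<open>v \<noteq> 0\<close>
      by (metis invertible_def matrix_vector_mul_assoc matrix_vector_mul_lid matrix_vector_mult_0_right)
  qed
  then have "0 < (transpose R *v v) \<bullet> (A *v (transpose R *v v))"
    using A by (simp add: pos_def_def)
  also have "\<dots> = v \<bullet> ((R ** A ** transpose R) *v v)"
    by (simp add: inner_matrix_vector[symmetric] matrix_vector_mul_assoc matrix_mul_assoc del: transpose_matrix_vector)
  finally show "0 < v \<bullet> ((R ** A ** transpose R) *v v)" .
qed

lemma pos_def_scaleR: "c > 0 \<Longrightarrow> pos_def A \<Longrightarrow> pos_def (c *\<^sub>R A)"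
  by (simp add: pos_def_def transpose_scalar scaleR_matrix_vector_assoc[symmetric])

lemma pos_def_scaleR_mat_1: "c > 0 \<Longrightarrow> pos_def (c *\<^sub>R (mat 1 :: real^'m^'m))"
  by (simp add: pos_def_def transpose_scalar scaleR_matrix_vector_assoc[symmetric])

lemma pos_def_inverse_factorization:
  fixes A :: "real^'m^'m"
  assumes "pos_def A"
  obtains R where "matrix_inv A = transpose R ** R" "det R \<noteq> 0"
proof -
  obtain P where P: "det P \<noteq> 0" "A = P ** transpose P"
    using pos_def_factorization[OF assms] by blast
  have dA: "det A \<noteq> 0" using pos_def_det_pos[OF assms] by simp
  note inv = matrix_inv_inverse[OF P(1)] matrix_inv_inverse[OF dA]
  define R where "R = matrix_inv P"
  have R: "R ** P = mat 1" "P ** R = mat 1" by (simp_all add: R_def inv)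
  have RT: "transpose P ** transpose R = mat 1"
    by (metis R(1) matrix_transpose_mul transpose_mat)
  have "matrix_inv A = matrix_inv A ** (P ** (transpose P ** transpose R) ** R)"
    by (simp add: RT R)
  also have "\<dots> = (matrix_inv A ** A) ** (transpose R ** R)"
    by (simp add: P(2) matrix_mul_assoc)
  finally have "matrix_inv A = transpose R ** R" by (simp add: inv)
  moreover have "det R \<noteq> 0" using R(1) det_mul[of R P] by auto
  ultimately show ?thesis using that by blast
qed

text \<open>
  The inequality \<open>t \<le> exp (t - 1)\<close>, multiplied over the eigenvalues. Equality holds at the identity
  matrix; this is what locates the maximizing covariance matrix.
\<close>

lemma pos_def_det_le_exp_trace:
  fixes A :: "real^'m^'m"
  assumes "pos_def A"
  shows "det A \<le> exp (trace A - real CARD('m))"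
proof -
  obtain Q d where Q: "orthogonal_matrix Q" "\<And>i. d i > 0" and A: "A = Q ** diagonal d ** transpose Q"
    using pos_def_diagonalization[OF assms] by metis
  have "det (Q ** transpose Q) = 1" using Q(1) by (simp add: orthogonal_matrix_def)
  then have "det A = (\<Prod>i\<in>UNIV. d i)" by (simp add: A det_mul det_diagonal_matrix)
  also have "\<dots> \<le> (\<Prod>i\<in>UNIV. exp (d i - 1))"
    using Q(2) exp_ge_add_one_self[of "d i - 1" for i] by (intro prod_mono) (auto simp: less_imp_le)
  also have "\<dots> = exp (trace (diagonal d) - real CARD('m))"
    by (simp add: exp_sum[symmetric] trace_diagonal sum_subtractf)
  also have "trace (diagonal d) = trace (diagonal d ** (transpose Q ** Q))"
    using Q(1) by (simp add: orthogonal_matrix_def)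
  also have "\<dots> = trace A"
    by (subst matrix_mul_assoc, subst trace_mul_sym) (simp add: A matrix_mul_assoc)
  finally show ?thesis .
qed

section \<open>Outer products\<close>

lemma outer_vector: "outer u v *v x = (v \<bullet> x) *\<^sub>R u"
  by (simp add: outer_def matrix_vector_mult_def vec_eq_iff inner_vec_def sum_distrib_left sum_distrib_right mult_ac)

lemma transpose_outer [simp]: "transpose (outer u v) = outer v u"
  by (simp add: outer_def transpose_def vec_eq_iff)

lemma outer_congruence: "P ** outer u v ** transpose P = outer (P *v u) (P *v v)"
  by (simp add: matrix_eq matrix_vector_mul_assoc[symmetric] outer_vector inner_matrix_vector[symmetric]
      matrix_vector_mult_scaleR inner_commute dot_lmul_matrix del: transpose_matrix_vector)
     (simp add: inner_matrix_vector inner_commute)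

lemma trace_mult_outer: "trace (A ** outer u v) = v \<bullet> (A *v u)"
  by (simp add: trace_def outer_def matrix_matrix_mult_def inner_vec_def matrix_vector_mult_def
      sum_distrib_left sum_distrib_right mult_ac)

lemma trace_mult_sum_outer:
  fixes u :: "'i \<Rightarrow> real^'m"
  shows "trace (A ** (\<Sum>i\<in>S. outer (u i) (u i))) = (\<Sum>i\<in>S. u i \<bullet> (A *v u i))"
proof (induction S rule: infinite_finite_induct)
  case (insert i S)
  then show ?case by (simp add: matrix_add_ldistrib trace_add trace_mult_outer)
qed (simp_all add: trace_def matrix_matrix_mult_def)

lemma outer_bilinear:
  "outer (u + u') v = outer u v + outer u' v" "outer u (v + v') = outer u v + outer u v'"
  "outer (u - u') v = outer u v - outer u' v" "outer u (v - v') = outer u v - outer u v'"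
  "outer (c *\<^sub>R u) v = c *\<^sub>R outer u v" "outer u (c *\<^sub>R v) = c *\<^sub>R outer u v"
  by (simp_all add: outer_def vec_eq_iff algebra_simps)

lemma outer_zero: "outer 0 v = 0" "outer u 0 = 0"
  by (simp_all add: outer_def vec_eq_iff)

lemma outer_sum: "outer (\<Sum>i\<in>S. u i) (\<Sum>j\<in>T. v j) = (\<Sum>i\<in>S. \<Sum>j\<in>T. outer (u i) (v j))"
  by (simp add: outer_def vec_eq_iff sum_product sum_component)

text \<open>
  An orthogonal map that moves \<open>u\<close> to a coordinate axis makes the matrix diagonal, with one entry different
  from 1.
\<close>

lemma det_mat_1_plus_outer: "det (mat 1 + outer u u) = 1 + u \<bullet> u" for u :: "real^'m"
proof -
  define k :: 'm where "k = undefined"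
  obtain f where f: "orthogonal_transformation f" "f (axis k (norm u)) = u"
    using orthogonal_transformation_exists[of "axis k (norm u)" u] by (auto simp: norm_eq_sqrt_inner inner_axis_axis)
  define Q where "Q = matrix f"
  have Q: "orthogonal_matrix Q" "Q *v axis k (norm u) = u"
    using f by (auto simp: orthogonal_transformation_matrix Q_def matrix_works)
  have dQ: "det (Q ** transpose Q) = 1" using Q(1) by (simp add: orthogonal_matrix_def)
  have "outer u u = Q ** outer (axis k (norm u)) (axis k (norm u)) ** transpose Q"
    by (simp only: outer_congruence Q(2))
  then have "mat 1 + outer u u = Q ** (mat 1 + outer (axis k (norm u)) (axis k (norm u))) ** transpose Q"
    using Q(1) by (simp add: matrix_add_ldistrib matrix_add_rdistrib orthogonal_matrix_def)
  then have "det (mat 1 + outer u u) = det (mat 1 + outer (axis k (norm u)) (axis k (norm u)))"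
    using dQ by (simp add: det_mul)
  also have "mat 1 + outer (axis k (norm u)) (axis k (norm u)) = diagonal (\<lambda>i. if i = k then 1 + u \<bullet> u else 1)"
    by (auto simp: diagonal_def outer_def axis_def mat_def vec_eq_iff power2_norm_eq_inner simp flip: power2_eq_square)
  also have "det \<dots> = 1 + u \<bullet> u"
    by (simp add: det_diagonal_matrix)
  finally show ?thesis .
qed

lemma continuous_on_det [continuous_intros]:
  fixes f :: "'a::topological_space \<Rightarrow> real^'m^'m"
  assumes "continuous_on S f"
  shows "continuous_on S (\<lambda>x. det (f x))"
  unfolding det_def using assms by (intro continuous_intros)

lemma continuous_on_outer [continuous_intros]:
  fixes f g :: "'a::topological_space \<Rightarrow> real^'m"
  assumes "continuous_on S f" "continuous_on S g"
  shows "continuous_on S (\<lambda>x. outer (f x) (g x))"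
  unfolding outer_def using assms by (intro continuous_intros)

lemma borel_measurable_outer [measurable]:
  fixes f g :: "'a \<Rightarrow> real^'m"
  assumes "f \<in> borel_measurable M" "g \<in> borel_measurable M"
  shows "(\<lambda>x. outer (f x) (g x)) \<in> borel_measurable M"
  using assms by (rule borel_measurable_continuous_Pair) (intro continuous_intros)

lemma borel_measurable_det [measurable]:
  fixes f :: "'a \<Rightarrow> real^'m^'m"
  assumes "f \<in> borel_measurable M"
  shows "(\<lambda>x. det (f x)) \<in> borel_measurable M"
  by (rule borel_measurable_continuous_on[OF _ assms]) (intro continuous_intros)

section \<open>Lebesgue measure under translations, linear maps and products\<close>

lemma nn_integral_lborel_translation:
  fixes f :: "'a::euclidean_space \<Rightarrow> ennreal"
  assumes [measurable]: "f \<in> borel_measurable borel"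
  shows "(\<integral>\<^sup>+x. f (x + c) \<partial>lborel) = (\<integral>\<^sup>+x. f x \<partial>lborel)"
  by (subst (2) lborel_distr_plus[of c, symmetric]) (simp add: nn_integral_distr add.commute)

text \<open>
  The uniqueness argument for Haar measure, with the indicator \<open>g\<close> of the unit ball as test function.
  In the double integral of \<open>f (T x) g y\<close> the variable \<open>x\<close> is translated by \<open>T\<^sup>-\<^sup>1 y\<close> and then \<open>y\<close> by
  \<open>- T x\<close>, which gives the double integral of \<open>f y g (y - T x)\<close>. The inner integral over \<open>x\<close> is
  the volume of a unit ball because \<open>T\<close> is an isometry.
\<close>

lemma nn_integral_orthogonal_transformation:
  fixes f :: "'a::euclidean_space \<Rightarrow> ennreal" and T :: "'a \<Rightarrow> 'a"
  assumes T: "orthogonal_transformation T" and [measurable]: "f \<in> borel_measurable borel"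
  shows "(\<integral>\<^sup>+x. f (T x) \<partial>lborel) = (\<integral>\<^sup>+x. f x \<partial>lborel)"
proof -
  define V :: ennreal where "V = emeasure lborel (ball (0 :: 'a) 1)"
  define g :: "'a \<Rightarrow> ennreal" where "g = indicator (ball 0 1)"
  have V: "emeasure lborel (ball (c :: 'a) 1) = V" for c
    by (simp add: V_def emeasure_ball)
  have V_finite: "V \<noteq> 0" "V \<noteq> \<infinity>"
    using unit_ball_vol_pos[OF of_nat_0_le_iff, of "DIM('a)", THEN less_imp_neq, THEN not_sym]
    by (simp_all add: V_def emeasure_ball)
  have lin: "linear T" and normT: "\<And>x. norm (T x) = norm x"
    using T by (auto simp: orthogonal_transformation)
  have surj: "surj T" using T by (rule orthogonal_transformation_surj)
  have "T \<in> borel_measurable borel"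
    using lin by (intro borel_measurable_continuous_onI linear_continuous_on linear_conv_bounded_linear[THEN iffD1])
  note [measurable] = this
  have [measurable]: "g \<in> borel_measurable borel" by (auto simp: g_def intro!: borel_measurable_indicator)
  have int_g: "(\<integral>\<^sup>+x. g x \<partial>lborel) = V" by (simp add: g_def V)
  have shift: "(\<integral>\<^sup>+x. f (T x) \<partial>lborel) = (\<integral>\<^sup>+x. f (T x + y) \<partial>lborel)" for y
  proof -
    obtain z where "y = T z" using surj by blast
    then show ?thesis
      using nn_integral_lborel_translation[of "\<lambda>x. f (T x)" z] by (simp add: linear_add[OF lin])
  qed
  have ball: "(\<integral>\<^sup>+x. g (y - T x) \<partial>lborel) = V" for y
  proof -
    obtain z where z: "y = T z" using surj by blast
    have "g (y - T x) = indicator (ball z 1) x" for x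
    proof -
      have "norm (y - T x) = norm (z - x)"
        by (metis linear_diff[OF lin] normT z)
      then show ?thesis by (simp add: g_def indicator_def dist_norm norm_minus_commute)
    qed
    then show ?thesis using V by simp
  qed
  have "(\<integral>\<^sup>+x. f (T x) \<partial>lborel) * V = (\<integral>\<^sup>+y. (\<integral>\<^sup>+x. f (T x) \<partial>lborel) * g y \<partial>lborel)"
    by (simp add: nn_integral_cmult int_g)
  also have "\<dots> = (\<integral>\<^sup>+y. (\<integral>\<^sup>+x. f (T x + y) * g y \<partial>lborel) \<partial>lborel)"
  proof (rule nn_integral_cong)
    fix y
    show "(\<integral>\<^sup>+x. f (T x) \<partial>lborel) * g y = (\<integral>\<^sup>+x. f (T x + y) * g y \<partial>lborel)"
      unfolding shift[of y] by (rule nn_integral_multc[symmetric]) measurable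
  qed
  also have "\<dots> = (\<integral>\<^sup>+x. (\<integral>\<^sup>+y. f (T x + y) * g y \<partial>lborel) \<partial>lborel)"
    by (rule lborel_pair.Fubini') measurable
  also have "\<dots> = (\<integral>\<^sup>+x. (\<integral>\<^sup>+y. f y * g (y - T x) \<partial>lborel) \<partial>lborel)"
  proof (rule nn_integral_cong)
    fix x
    show "(\<integral>\<^sup>+y. f (T x + y) * g y \<partial>lborel) = (\<integral>\<^sup>+y. f y * g (y - T x) \<partial>lborel)"
      using nn_integral_lborel_translation[of "\<lambda>y. f y * g (y - T x)" "T x"]
      by (simp add: add.commute)
  qed
  also have "\<dots> = (\<integral>\<^sup>+y. (\<integral>\<^sup>+x. f y * g (y - T x) \<partial>lborel) \<partial>lborel)"
    by (rule lborel_pair.Fubini') measurable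
  also have "\<dots> = (\<integral>\<^sup>+y. f y \<partial>lborel) * V"
    by (simp add: nn_integral_cmult nn_integral_multc ball)
  finally show ?thesis
    using V_finite by (simp add: mult.commute[of _ V] ennreal_mult_cancel_left)
qed

lemma nn_integral_diagonal_scaling:
  fixes f :: "real^'m \<Rightarrow> ennreal"
  assumes [measurable]: "f \<in> borel_measurable borel" and d: "\<And>i. d i > 0"
  shows "(\<integral>\<^sup>+x. f x \<partial>lborel) = ennreal (det (diagonal d)) * (\<integral>\<^sup>+x. f (diagonal d *v x) \<partial>lborel)"
proof -
  define c where "c b = d (axis_index b)" for b :: "real^'m"
  have c: "c b > 0" for b using d by (simp add: c_def)
  have Basis: "Basis = range (\<lambda>i. axis i 1 :: real^'m)"
    by (auto simp: Basis_vec_def)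
  have inj: "inj (\<lambda>i. axis i 1 :: real^'m)" by (auto simp: inj_on_def axis_eq_axis)
  have c_ax: "c (axis i 1) = d i" for i by (simp add: c_def axis_index_axis)
  have T: "0 + (\<Sum>j\<in>Basis. (c j * (x \<bullet> j)) *\<^sub>R j) = diagonal d *v x" for x
    unfolding Basis sum.reindex[OF inj]
    by (simp add: c_ax vec_eq_iff diagonal_vector inner_axis sum_component)
      (simp add: axis_def
        if_distrib[where f="\<lambda>t. _ * t"] cong: if_cong)
  have P: "(\<Prod>j\<in>Basis. \<bar>c j\<bar>) = det (diagonal d)"
    unfolding Basis prod.reindex[OF inj]
    by (auto simp: c_ax det_diagonal_matrix d less_imp_le intro!: prod.cong abs_of_nonneg)
  have [measurable]: "(\<lambda>x. diagonal d *v x) \<in> borel_measurable borel"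
    by (intro borel_measurable_continuous_onI linear_continuous_on matrix_vector_mul_bounded_linear)
  have eq: "lborel = density (distr lborel borel (\<lambda>x. diagonal d *v x)) (\<lambda>_. ennreal (det (diagonal d)))"
    using lborel_affine_euclidean[of c 0] c unfolding T P by (metis less_numeral_extra(3))
  show ?thesis
    by (subst eq) (simp add: nn_integral_density nn_integral_distr nn_integral_cmult)
qed

text \<open>
  The polar decomposition of \<open>P\<close> reduces the substitution to two orthogonal maps and one diagonal scaling:
  if \<open>P P\<^sup>T = Q D Q\<^sup>T\<close> and \<open>s\<^sup>2 = D\<close>, then \<open>P = Q s R\<close> with \<open>R = s\<^sup>-\<^sup>1 Q\<^sup>T P\<close> orthogonal.
\<close>

theorem nn_integral_matrix_substitution:
  fixes f :: "real^'m \<Rightarrow> ennreal" and P :: "real^'m^'m"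
  assumes [measurable]: "f \<in> borel_measurable borel" and P: "det P \<noteq> 0"
  shows "(\<integral>\<^sup>+x. f x \<partial>lborel) = ennreal \<bar>det P\<bar> * (\<integral>\<^sup>+x. f (P *v x) \<partial>lborel)"
proof -
  have meas [measurable]: "(\<lambda>x. A *v x) \<in> borel_measurable borel" for A :: "real^'m^'m"
    by (intro borel_measurable_continuous_onI linear_continuous_on matrix_vector_mul_bounded_linear)
  have "pos_def (mat 1 :: real^'m^'m)"
    by (simp add: pos_def_def)
  then have "pos_def (P ** transpose P)"
    using pos_def_congruence[of "mat 1" P] P by simp
  then obtain Q d where Q: "orthogonal_matrix Q" "\<And>i. d i > 0"
    and PP: "P ** transpose P = Q ** diagonal d ** transpose Q"
    using pos_def_diagonalization by metis
  define s where "s i = sqrt (d i)" for i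
  have s: "s i > 0" "s i * s i = d i" for i using Q(2)[of i] by (auto simp: s_def)
  define R where "R = diagonal (\<lambda>i. 1 / s i) ** transpose Q ** P"
  have inv: "diagonal s ** diagonal (\<lambda>i. 1 / s i) = mat 1" "diagonal (\<lambda>i. 1 / s i) ** diagonal s = mat 1"
    using s(1)[THEN less_imp_neq, THEN not_sym] by (simp_all add: diagonal_mult) (simp_all add: diagonal_def mat_def)
  have QQ: "Q ** transpose Q = mat 1" "transpose Q ** Q = mat 1"
    using Q(1) by (simp_all add: orthogonal_matrix_def)
  have PR: "P = Q ** (diagonal s ** R)"
  proof -
    have "Q ** (diagonal s ** R) = Q ** ((diagonal s ** diagonal (\<lambda>i. 1 / s i)) ** (transpose Q ** P))"
      by (simp add: R_def matrix_mul_assoc)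
    then show ?thesis by (simp add: inv matrix_mul_assoc QQ)
  qed
  have "R ** transpose R = diagonal (\<lambda>i. 1 / s i) ** transpose Q ** (P ** transpose P) ** Q ** diagonal (\<lambda>i. 1 / s i)"
    by (simp add: R_def matrix_transpose_mul matrix_mul_assoc)
  also have "\<dots> = diagonal (\<lambda>i. 1 / s i) ** (transpose Q ** Q) ** diagonal d ** (transpose Q ** Q) ** diagonal (\<lambda>i. 1 / s i)"
    by (simp only: PP matrix_mul_assoc)
  also have "\<dots> = (diagonal (\<lambda>i. 1 / s i) ** diagonal s) ** (diagonal s ** diagonal (\<lambda>i. 1 / s i))"
    by (simp add: QQ matrix_mul_assoc) (simp only: diagonal_mult s(2)[symmetric] mult.assoc)
  also have "\<dots> = mat 1" by (simp add: inv)
  finally have R: "orthogonal_matrix R"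
    by (metis orthogonal_matrix orthogonal_matrix_transpose transpose_transpose)
  have orth: "orthogonal_transformation (\<lambda>x. A *v x)" if "orthogonal_matrix A" for A :: "real^'m^'m"
    using that by (simp add: orthogonal_transformation_matrix)
  have abs1: "\<bar>det A\<bar> = 1" if "orthogonal_matrix A" for A :: "real^'m^'m"
    using det_orthogonal_matrix[OF that] by auto
  have "(\<integral>\<^sup>+x. f (P *v x) \<partial>lborel) = (\<integral>\<^sup>+x. f (Q *v (diagonal s *v (R *v x))) \<partial>lborel)"
    by (subst PR) (simp add: matrix_vector_mul_assoc)
  also have "\<dots> = (\<integral>\<^sup>+x. f (Q *v (diagonal s *v x)) \<partial>lborel)"
    by (rule nn_integral_orthogonal_transformation[OF orth[OF R]]) measurable
  finally have "ennreal (det (diagonal s)) * (\<integral>\<^sup>+x. f (P *v x) \<partial>lborel) = (\<integral>\<^sup>+x. f (Q *v x) \<partial>lborel)"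
    using nn_integral_diagonal_scaling[of "\<lambda>x. f (Q *v x)" s] s(1) by simp
  also have "\<dots> = (\<integral>\<^sup>+x. f x \<partial>lborel)"
    by (rule nn_integral_orthogonal_transformation[OF orth[OF Q(1)]]) measurable
  also have "det (diagonal s) = \<bar>det P\<bar>"
    by (subst PR) (use s(1) in \<open>simp add: det_mul abs_mult abs1 R Q(1) det_diagonal_matrix prod_nonneg less_imp_le\<close>)
  finally show ?thesis by simp
qed

lemma measurable_vec_lambda_PiM:
  "(\<lambda>x. \<chi> i. x i) \<in> PiM UNIV (\<lambda>_ :: 'n::finite. lborel :: 'a::euclidean_space measure) \<rightarrow>\<^sub>M borel"
proof (rule borel_measurable_euclidean_space[THEN iffD2], safe)
  fix b :: "'a^'n" assume "b \<in> Basis"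
  then obtain i u where b: "b = axis i u" by (auto simp: Basis_vec_def)
  show "(\<lambda>x. (\<chi> i. x i) \<bullet> b) \<in> borel_measurable (PiM UNIV (\<lambda>_. lborel))"
    by (simp add: b inner_axis)
qed

text \<open>
  The components may themselves be vectors: applied to a sample this integrates over one observation
  at a time, applied to a single observation over one coordinate at a time.
\<close>

lemma lborel_vec_eq_distr_PiM:
  "(lborel :: (('a::euclidean_space)^'n) measure) =
     distr (PiM UNIV (\<lambda>_. lborel)) borel (\<lambda>x. \<chi> i. x i)"
proof (rule lborel_eqI)
  note meas = measurable_vec_lambda_PiM
  interpret product_sigma_finite "\<lambda>_ :: 'n. lborel :: 'a measure" ..
  fix l u :: "'a^'n" assume le: "\<And>b. b \<in> Basis \<Longrightarrow> l \<bullet> b \<le> u \<bullet> b"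
  have le': "l $ i \<bullet> b \<le> u $ i \<bullet> b" if "b \<in> Basis" for i b
    using le[of "axis i b"] that by (simp add: inner_axis)
  have "(\<lambda>x. \<chi> i. x i) -` box l u \<inter> space (PiM UNIV (\<lambda>_. lborel)) = (\<Pi>\<^sub>E i\<in>UNIV. box (l $ i) (u $ i))"
    by (auto simp: mem_box Basis_vec_def inner_axis space_PiM PiE_iff)
  then have "emeasure (distr (PiM UNIV (\<lambda>_. lborel)) borel (\<lambda>x. \<chi> i. x i)) (box l u) =
      (\<Prod>i\<in>UNIV. emeasure lborel (box (l $ i) (u $ i)))"
    by (simp add: emeasure_distr[OF meas] emeasure_PiM)
  also have "\<dots> = (\<Prod>i\<in>UNIV. ennreal (\<Prod>b\<in>Basis. (u $ i - l $ i) \<bullet> b))"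
    using le' by simp
  also have "\<dots> = ennreal (\<Prod>i\<in>UNIV. \<Prod>b\<in>Basis. (u $ i - l $ i) \<bullet> b)"
    using le' by (intro prod_ennreal prod_nonneg) (auto simp: inner_diff_left)
  also have "(\<Prod>i\<in>UNIV. \<Prod>b\<in>Basis. (u $ i - l $ i) \<bullet> b) = (\<Prod>b\<in>Basis. (u - l) \<bullet> b)"
  proof -
    have "(\<Prod>b\<in>Basis. (u - l) \<bullet> b) = (\<Prod>(i, b)\<in>UNIV \<times> Basis. (u - l) \<bullet> axis i b)"
    proof -
      have "bij_betw (\<lambda>(i, b). axis i b) (UNIV \<times> Basis) (Basis :: ('a^'n) set)"
        by (auto simp: bij_betw_def inj_on_def axis_eq_axis Basis_vec_def image_iff nonzero_Basis)
      from prod.reindex_bij_betw[OF this, of "\<lambda>b. (u - l) \<bullet> b"] show ?thesis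
        by (simp add: case_prod_beta)
    qed
    also have "\<dots> = (\<Prod>i\<in>UNIV. \<Prod>b\<in>Basis. (u $ i - l $ i) \<bullet> b)"
      by (simp add: prod.cartesian_product[symmetric] inner_axis)
    finally show ?thesis by simp
  qed
  finally show "emeasure (distr (PiM UNIV (\<lambda>_. lborel)) borel (\<lambda>x. \<chi> i. x i)) (box l u) =
      ennreal (\<Prod>b\<in>Basis. (u - l) \<bullet> b)" .
qed simp

lemma nn_integral_lborel_vec:
  fixes f :: "('a::euclidean_space)^'n \<Rightarrow> ennreal"
  assumes "f \<in> borel_measurable borel"
  shows "(\<integral>\<^sup>+x. f x \<partial>lborel) = (\<integral>\<^sup>+x. f (\<chi> i. x i) \<partial>PiM UNIV (\<lambda>_. lborel))"
  by (subst lborel_vec_eq_distr_PiM) (use assms in \<open>simp add: nn_integral_distr[OF measurable_vec_lambda_PiM]\<close>)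

section \<open>The multivariate Student integral\<close>

lemma nn_integral_Gamma_scaled:
  fixes a q :: real
  assumes a: "a > 0" and q: "q > 0"
  shows "(\<integral>\<^sup>+t. ennreal (indicator {0..} t * t powr (a - 1) * exp (- (t * q))) \<partial>lborel) =
    ennreal (Gamma a * q powr (- a))"
proof -
  let ?h = "\<lambda>t. ennreal (indicator {0..} t * t powr (a - 1) / exp t)"
  let ?I = "\<integral>\<^sup>+t. ennreal (indicator {0..} t * t powr (a - 1) * exp (- (t * q))) \<partial>lborel"
  have "ennreal (Gamma a) = (\<integral>\<^sup>+t. ?h t \<partial>lborel)"
    by (rule Gamma_conv_nn_integral_real[OF a])
  also have "\<dots> = ennreal q * (\<integral>\<^sup>+t. ?h (0 + q * t) \<partial>lborel)"
    using q by (subst nn_integral_real_affine[of _ q 0]) simp_all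
  also have "(\<integral>\<^sup>+t. ?h (0 + q * t) \<partial>lborel) =
      (\<integral>\<^sup>+t. ennreal (q powr (a - 1)) * ennreal (indicator {0..} t * t powr (a - 1) * exp (- (t * q))) \<partial>lborel)"
    using q by (intro nn_integral_cong)
      (auto simp: indicator_def zero_le_mult_iff powr_mult exp_minus field_simps simp flip: ennreal_mult')
  also have "\<dots> = ennreal (q powr (a - 1)) * ?I"
    by (rule nn_integral_cmult) measurable
  finally have "ennreal (Gamma a) = ennreal (q powr a) * ?I"
    using q by (simp add: mult.assoc[symmetric] powr_diff flip: ennreal_mult')
  then have "ennreal (q powr (- a)) * ennreal (Gamma a) = (ennreal (q powr (- a)) * ennreal (q powr a)) * ?I"
    by (simp add: mult.assoc)
  also have "ennreal (q powr (- a)) * ennreal (q powr a) = 1"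
    using q by (simp flip: ennreal_mult' powr_add)
  finally show ?thesis
    using Gamma_real_pos[OF a] by (simp add: mult.commute flip: ennreal_mult')
qed

lemma nn_integral_gaussian:
  assumes s: "s > 0"
  shows "(\<integral>\<^sup>+x. ennreal (exp (- (s * x\<^sup>2))) \<partial>lborel) = ennreal ((pi / s) powr (1 / 2))"
proof -
  define \<sigma> where "\<sigma> = sqrt (1 / (2 * s))"
  have \<sigma>: "\<sigma> > 0" "\<sigma>\<^sup>2 = 1 / (2 * s)" using s by (auto simp: \<sigma>_def)
  have eq: "exp (- (s * x\<^sup>2)) = sqrt (pi / s) * normal_density 0 \<sigma> x" for x
    using s by (simp add: normal_density_def \<sigma>(2) mult.commute real_sqrt_mult real_sqrt_divide)
  have "(\<integral>\<^sup>+x. ennreal (normal_density 0 \<sigma> x) \<partial>lborel) = 1"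
    using \<sigma> by (subst nn_integral_eq_integral) auto
  then show ?thesis
    using s by (simp add: eq ennreal_mult' nn_integral_cmult powr_half_sqrt)
qed

lemma nn_integral_gaussian_vec:
  assumes s: "s > 0"
  shows "(\<integral>\<^sup>+x. ennreal (exp (- (s * (x \<bullet> x)))) \<partial>(lborel :: (real^'m) measure)) =
    ennreal ((pi / s) powr (real CARD('m) / 2))"
proof -
  interpret product_sigma_finite "\<lambda>_ :: 'm. lborel :: real measure" ..
  have "(\<integral>\<^sup>+x. ennreal (exp (- (s * (x \<bullet> x)))) \<partial>(lborel :: (real^'m) measure)) =
      (\<integral>\<^sup>+x. (\<Prod>i\<in>UNIV. ennreal (exp (- (s * (x i)\<^sup>2)))) \<partial>PiM (UNIV :: 'm set) (\<lambda>_. lborel))"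
    by (subst nn_integral_lborel_vec)
      (auto simp: prod_ennreal inner_vec_def power2_eq_square sum_distrib_left simp flip: exp_sum sum_negf)
  also have "\<dots> = (\<Prod>i\<in>(UNIV :: 'm set). \<integral>\<^sup>+x. ennreal (exp (- (s * x\<^sup>2))) \<partial>lborel)"
    by (rule product_nn_integral_prod) auto
  also have "\<dots> = ennreal ((pi / s) powr (real CARD('m) / 2))"
    using s by (simp add: nn_integral_gaussian ennreal_power powr_power)
  finally show ?thesis .
qed

text \<open>
  The total mass of the unnormalized multivariate Student density
  \<open>(1 + |y|\<^sup>2)\<^sup>-\<^sup>a\<close> on \<open>m\<close>-dimensional space.
\<close>

definition student_integral :: "nat \<Rightarrow> real \<Rightarrow> real" where
  "student_integral m a = pi powr (real m / 2) * (Gamma (a - real m / 2) / Gamma a)"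

lemma student_integral_nonneg: "a > real m / 2 \<Longrightarrow> student_integral m a \<ge> 0"
  by (auto simp: student_integral_def intro!: mult_nonneg_nonneg divide_nonneg_nonneg Gamma_real_nonneg)

text \<open>
  Writing the integrand as a mixture of Gaussians,
  \<open>\<Gamma>(a) q\<^sup>-\<^sup>a = \<integral> t\<^sup>a\<^sup>-\<^sup>1 exp (- t q) dt\<close> with \<open>q = 1 + |y|\<^sup>2\<close>, the integral over \<open>y\<close> becomes
  elementary and leaves a Gamma integral with parameter \<open>a - m/2\<close>.
\<close>

lemma nn_integral_student:
  assumes a: "a > real CARD('m) / 2"
  shows "(\<integral>\<^sup>+y. ennreal ((1 + y \<bullet> y) powr (- a)) \<partial>(lborel :: (real^'m) measure)) =
    ennreal (student_integral CARD('m) a)"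
proof -
  let ?m = "real CARD('m)"
  let ?J = "\<integral>\<^sup>+y. ennreal ((1 + y \<bullet> y) powr (- a)) \<partial>(lborel :: (real^'m) measure)"
  have a0: "a > 0" using a by (rule le_less_trans[rotated]) simp
  have pos: "1 + y \<bullet> y > 0" for y :: "real^'m" by (simp add: add_pos_nonneg)
  have "ennreal (Gamma a) * ?J = (\<integral>\<^sup>+y. ennreal (Gamma a * (1 + y \<bullet> y) powr (- a)) \<partial>(lborel :: (real^'m) measure))"
    using Gamma_real_pos[OF a0] by (simp add: nn_integral_cmult ennreal_mult')
  also have "\<dots> = (\<integral>\<^sup>+y. \<integral>\<^sup>+t. ennreal (indicator {0..} t * t powr (a - 1) * exp (- (t * (1 + y \<bullet> y)))) \<partial>lborel \<partial>(lborel :: (real^'m) measure))"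
    by (simp add: nn_integral_Gamma_scaled[OF a0 pos])
  also have "\<dots> = (\<integral>\<^sup>+t. \<integral>\<^sup>+y. ennreal (indicator {0..} t * t powr (a - 1) * exp (- (t * (1 + y \<bullet> y)))) \<partial>(lborel :: (real^'m) measure) \<partial>lborel)"
    by (rule lborel_pair.Fubini') measurable
  also have "\<dots> = (\<integral>\<^sup>+t. ennreal (pi powr (?m / 2)) *
      ennreal (indicator {0..} t * t powr (a - ?m / 2 - 1) * exp (- (t * 1))) \<partial>lborel)"
  proof (rule nn_integral_cong)
    fix t :: real
    let ?L = "\<integral>\<^sup>+y. ennreal (indicator {0..} t * t powr (a - 1) * exp (- (t * (1 + y \<bullet> y)))) \<partial>(lborel :: (real^'m) measure)"
    show "?L = ennreal (pi powr (?m / 2)) * ennreal (indicator {0..} t * t powr (a - ?m / 2 - 1) * exp (- (t * 1)))"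
    \<comment> \<open>at \<open>t = 0\<close> both sides vanish because \<open>0 powr _ = 0\<close>\<close>
    proof (cases "t > 0")
      case True
      have "?L = (\<integral>\<^sup>+y. ennreal (t powr (a - 1) * exp (- t)) * ennreal (exp (- (t * (y \<bullet> y)))) \<partial>(lborel :: (real^'m) measure))"
        using True by (intro nn_integral_cong)
          (simp add: exp_add[symmetric] algebra_simps flip: ennreal_mult')
      also have "\<dots> = ennreal (t powr (a - 1) * exp (- t)) * ennreal ((pi / t) powr (?m / 2))"
        using True by (simp add: nn_integral_cmult nn_integral_gaussian_vec)
      also have "\<dots> = ennreal (pi powr (?m / 2)) * ennreal (indicator {0..} t * t powr (a - ?m / 2 - 1) * exp (- (t * 1)))"
        using True by (simp add: powr_divide powr_diff mult_ac flip: ennreal_mult')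
      finally show ?thesis .
    qed (auto simp: indicator_def)
  qed
  also have "\<dots> = ennreal (pi powr (?m / 2)) * ennreal (Gamma (a - ?m / 2) * 1 powr (- (a - ?m / 2)))"
    using a by (subst nn_integral_Gamma_scaled[symmetric]) (auto intro!: nn_integral_cmult)
  also have "\<dots> = ennreal (Gamma a) * ennreal (student_integral CARD('m) a)"
    using Gamma_real_pos[OF a0] by (simp add: student_integral_def flip: ennreal_mult')
  finally show ?thesis
    using Gamma_real_pos[OF a0] by (simp add: ennreal_mult_cancel_left)
qed

text \<open>
  With \<open>B = P P\<^sup>T\<close> the substitution \<open>x = v + P z / sqrt g\<close> turns the matrix into
  \<open>P (I + z z\<^sup>T) P\<^sup>T\<close>, so the determinant factors and the Student integral remains. The Jacobian
  contributes \<open>g\<^sup>-\<^sup>m\<^sup>/\<^sup>2\<close> and one square root of \<open>det B\<close>, which lowers the exponent by one half.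
\<close>

lemma nn_integral_det_rank_one_update:
  fixes B :: "real^'m^'m"
  assumes B: "pos_def B" and g: "g > 0" and a: "a > real CARD('m) / 2"
  shows "(\<integral>\<^sup>+x. ennreal (det (B + g *\<^sub>R outer (x - v) (x - v)) powr (- a)) \<partial>lborel) =
    ennreal (g powr (- (real CARD('m) / 2)) * det B powr (- (a - 1 / 2)) * student_integral CARD('m) a)"
proof -
  let ?f = "\<lambda>x. ennreal (det (B + g *\<^sub>R outer x x) powr (- a))"
  let ?K = "student_integral CARD('m) a"
  have [measurable]: "(\<lambda>x. det (B + g *\<^sub>R outer x x)) \<in> borel_measurable borel"
    by (intro borel_measurable_continuous_onI continuous_intros)
  obtain P where P: "det P \<noteq> 0" "B = P ** transpose P"
    using pos_def_factorization[OF B] by blast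
  have dB: "det B = \<bar>det P\<bar>\<^sup>2" by (simp add: P(2) det_mul power2_eq_square)
  define D :: "real^'m^'m" where "D = diagonal (\<lambda>_. 1 / sqrt g)"
  have detD: "det D = g powr (- (real CARD('m) / 2))"
  proof -
    have "1 / sqrt g = g powr (- (1 / 2))"
      using g by (simp add: powr_minus_divide powr_half_sqrt)
    then have "det D = (g powr (- (1 / 2))) ^ CARD('m)"
      by (simp only: D_def det_diagonal_matrix prod_constant)
    also have "\<dots> = g powr (- (real CARD('m) / 2))"
      using g by (subst powr_power) auto
    finally show ?thesis .
  qed
  have DPx: "(D ** P) *v z = (1 / sqrt g) *\<^sub>R (P *v z)" for z
    by (simp add: D_def matrix_vector_mul_assoc[symmetric] diagonal_vector vec_eq_iff)
  have det_eq: "det (B + g *\<^sub>R outer ((D ** P) *v z) ((D ** P) *v z)) = det B * (1 + z \<bullet> z)" for z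
  proof -
    have "B + g *\<^sub>R outer ((D ** P) *v z) ((D ** P) *v z) = B + outer (P *v z) (P *v z)"
      unfolding DPx using g by (simp add: outer_bilinear)
    also have "\<dots> = P ** (mat 1 + outer z z) ** transpose P"
      by (simp add: P(2) matrix_add_ldistrib matrix_add_rdistrib outer_congruence)
    finally show ?thesis by (simp add: det_mul det_mat_1_plus_outer P(2))
  qed
  have "(\<integral>\<^sup>+x. ?f (x - v) \<partial>lborel) = (\<integral>\<^sup>+x. ?f x \<partial>lborel)"
    using nn_integral_lborel_translation[of ?f "- v"] by simp
  also have "\<dots> = ennreal \<bar>det (D ** P)\<bar> * (\<integral>\<^sup>+z. ?f ((D ** P) *v z) \<partial>lborel)"
    using P(1) g detD by (intro nn_integral_matrix_substitution) (auto simp: det_mul)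
  also have "(\<integral>\<^sup>+z. ?f ((D ** P) *v z) \<partial>lborel) =
      (\<integral>\<^sup>+z. ennreal (det B powr (- a)) * ennreal ((1 + z \<bullet> z) powr (- a)) \<partial>(lborel :: (real^'m) measure))"
    using pos_def_det_pos[OF B] by (simp add: det_eq powr_mult less_imp_le flip: ennreal_mult')
  also have "\<dots> = ennreal (det B powr (- a)) * ennreal ?K"
    by (simp add: nn_integral_cmult nn_integral_student[OF a])
  also have "\<bar>det (D ** P)\<bar> = g powr (- (real CARD('m) / 2)) * det B powr (1 / 2)"
    by (simp add: det_mul abs_mult detD dB powr_half_sqrt)
  also have "ennreal (g powr (- (real CARD('m) / 2)) * det B powr (1 / 2)) * (ennreal (det B powr (- a)) * ennreal ?K) =
      ennreal (g powr (- (real CARD('m) / 2)) * (det B powr (1 / 2) * det B powr (- a)) * ?K)"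
    using student_integral_nonneg[OF a] by (simp add: mult_ac flip: ennreal_mult')
  also have "det B powr (1 / 2) * det B powr (- a) = det B powr (- (a - 1 / 2))"
    by (simp flip: powr_add)
  finally show ?thesis .
qed

section \<open>Integrating determinants of shrunken scatter matrices\<close>

text \<open>
  The scatter matrix of the observations in \<open>S\<close> about their mean when \<open>d\<close> further observations at the
  origin are imagined; \<open>d = 0\<close> is the usual centred scatter matrix.
\<close>

definition shrunken_scatter :: "real \<Rightarrow> 'i set \<Rightarrow> ('i \<Rightarrow> real^'m) \<Rightarrow> real^'m^'m" where
  "shrunken_scatter d S x =
     (\<Sum>i\<in>S. outer (x i) (x i)) - (1 / (d + real (card S))) *\<^sub>R outer (\<Sum>i\<in>S. x i) (\<Sum>i\<in>S. x i)"

lemma transpose_shrunken_scatter: "transpose (shrunken_scatter d S x) = shrunken_scatter d S x"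
  by (auto simp: shrunken_scatter_def transpose_def vec_eq_iff outer_def sum_component mult_ac)

lemma shrunken_scatter_vector:
  "shrunken_scatter d S x *v v =
     (\<Sum>i\<in>S. (x i \<bullet> v) *\<^sub>R x i) - (1 / (d + real (card S))) *\<^sub>R ((\<Sum>i\<in>S. x i) \<bullet> v) *\<^sub>R (\<Sum>i\<in>S. x i)"
proof -
  have *: "(\<Sum>i\<in>S. outer (x i) (x i)) *v v = (\<Sum>i\<in>S. (x i \<bullet> v) *\<^sub>R x i)"
    by (induction S rule: infinite_finite_induct)
       (simp_all add: matrix_vector_mult_add_rdistrib outer_vector)
  show ?thesis
    by (simp add: shrunken_scatter_def matrix_vector_mult_diff_rdistrib * scaleR_matrix_vector_assoc[symmetric] outer_vector)
qed

text \<open>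
  By the Cauchy-Schwarz inequality \<open>(\<Sum>t\<^sub>i)\<^sup>2 \<le> k \<Sum>t\<^sub>i\<^sup>2\<close> with \<open>t\<^sub>i = x\<^sub>i \<bullet> v\<close>.
\<close>

lemma shrunken_scatter_nonneg:
  assumes "finite S" "d > 0"
  shows "v \<bullet> (shrunken_scatter d S x *v v) \<ge> 0"
proof -
  let ?k = "real (card S)"
  let ?q = "\<Sum>i\<in>S. (x i \<bullet> v)\<^sup>2"
  have "(\<Sum>i\<in>S. (x i \<bullet> v) * 1)\<^sup>2 \<le> ?q * (\<Sum>i\<in>S. 1\<^sup>2)"
    by (rule Cauchy_Schwarz_ineq_sum)
  then have "(\<Sum>i\<in>S. x i \<bullet> v)\<^sup>2 \<le> ?q * ?k" by simp
  also have "\<dots> \<le> ?q * (d + ?k)" using assms by (intro mult_left_mono) (auto intro: sum_nonneg)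
  finally have "(\<Sum>i\<in>S. x i \<bullet> v)\<^sup>2 / (d + ?k) \<le> ?q"
    using assms by (simp add: pos_divide_le_eq add_pos_nonneg)
  moreover have "v \<bullet> (shrunken_scatter d S x *v v) = ?q - (\<Sum>i\<in>S. x i \<bullet> v)\<^sup>2 / (d + ?k)"
    by (simp add: shrunken_scatter_vector inner_diff_right inner_sum_right inner_sum_left
        power2_eq_square inner_commute)
  ultimately show ?thesis by simp
qed

lemma pos_def_add_shrunken_scatter:
  fixes B :: "real^'m^'m"
  assumes "pos_def B" "finite S" "d > 0"
  shows "pos_def (B + shrunken_scatter d S x)"
  unfolding pos_def_def
proof safe
  have "transpose (A + A') = transpose A + transpose A'" for A A' :: "real^'m^'m"
    by (simp add: transpose_def vec_eq_iff)
  then show "transpose (B + shrunken_scatter d S x) = B + shrunken_scatter d S x"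
    using assms(1) by (simp add: pos_def_def transpose_shrunken_scatter)
  fix v :: "real^'m" assume "v \<noteq> 0"
  then show "0 < v \<bullet> ((B + shrunken_scatter d S x) *v v)"
    using assms shrunken_scatter_nonneg[OF assms(2,3), of v x]
    by (simp add: pos_def_def matrix_vector_mult_add_rdistrib inner_add_right add_pos_nonneg)
qed

text \<open>
  Completing the square in the new observation. The centre is the shrunken mean of the old observations,
  and \<open>d\<close> does not change, which is why the observations can be integrated out by induction.
\<close>

lemma shrunken_scatter_insert:
  fixes x :: "'i \<Rightarrow> real^'m"
  assumes "finite S" "i \<notin> S" "d > 0"
  defines "e \<equiv> d + real (card S)"
  shows "shrunken_scatter d (insert i S) (x(i := y)) =
    shrunken_scatter d S x +
    (e / (e + 1)) *\<^sub>R outer (y - (1 / e) *\<^sub>R (\<Sum>i\<in>S. x i)) (y - (1 / e) *\<^sub>R (\<Sum>i\<in>S. x i))"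
proof -
  have e: "e > 0" using assms(3) by (simp add: e_def add_pos_nonneg)
  have sum: "(\<Sum>j\<in>S. (x(i := y)) j) = (\<Sum>j\<in>S. x j)"
    "(\<Sum>j\<in>S. outer ((x(i := y)) j) ((x(i := y)) j)) = (\<Sum>j\<in>S. outer (x j) (x j))"
    using assms(2) by (auto intro!: sum.cong)
  have card: "d + real (card (insert i S)) = e + 1" using assms(1,2) by (simp add: e_def)
  define s where "s = (\<Sum>j\<in>S. x j)"
  have "shrunken_scatter d (insert i S) (x(i := y)) =
      outer y y + (\<Sum>j\<in>S. outer (x j) (x j)) - (1 / (e + 1)) *\<^sub>R outer (y + s) (y + s)"
    unfolding shrunken_scatter_def card using assms(1,2) sum by (simp add: s_def)
  also have "outer y y - (1 / (e + 1)) *\<^sub>R outer (y + s) (y + s) =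
      (e / (e + 1)) *\<^sub>R outer (y - (1 / e) *\<^sub>R s) (y - (1 / e) *\<^sub>R s) - (1 / e) *\<^sub>R outer s s"
    using e by (simp add: outer_def vec_eq_iff divide_simps) (simp add: algebra_simps)
  then have "outer y y + (\<Sum>j\<in>S. outer (x j) (x j)) - (1 / (e + 1)) *\<^sub>R outer (y + s) (y + s) =
      shrunken_scatter d S x + (e / (e + 1)) *\<^sub>R outer (y - (1 / e) *\<^sub>R s) (y - (1 / e) *\<^sub>R s)"
    by (simp add: shrunken_scatter_def e_def[symmetric] s_def[symmetric] algebra_simps)
  finally show ?thesis by (simp only: s_def)
qed

lemma borel_measurable_shrunken_scatter [measurable]:
  assumes "\<And>i. i \<in> S \<Longrightarrow> (\<lambda>x. f x i) \<in> borel_measurable M"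
  shows "(\<lambda>x. shrunken_scatter d S (f x)) \<in> borel_measurable M"
  unfolding shrunken_scatter_def using assms by measurable

text \<open>
  Each observation that is integrated out contributes one Student integral and lowers the exponent \<open>a\<close>
  by one half, so the induction runs over all \<open>a\<close>. The factors \<open>(d + k) / (d + k + 1)\<close> telescope to
  \<open>d / (d + card S)\<close>.
\<close>

theorem nn_integral_det_shrunken_scatter:
  fixes B :: "real^'m^'m" and S :: "'i set"
  assumes "finite S" "pos_def B" "d > 0" "a > (real CARD('m) + real (card S) - 1) / 2"
  shows "(\<integral>\<^sup>+x. ennreal (det (B + shrunken_scatter d S x) powr (- a)) \<partial>PiM S (\<lambda>_. lborel)) =
    ennreal ((1 + real (card S) / d) powr (real CARD('m) / 2) * det B powr (- (a - real (card S) / 2)) *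
      (\<Prod>k<card S. student_integral CARD('m) (a - real k / 2)))"
  using assms(1,4)
proof (induction S arbitrary: a rule: finite_induct)
  case empty
  interpret product_sigma_finite "\<lambda>_ :: 'i. lborel :: (real^'m) measure" ..
  show ?case by (simp add: PiM_empty nn_integral_count_space_finite outer_zero shrunken_scatter_def)
next
  case (insert i S)
  interpret product_sigma_finite "\<lambda>_ :: 'i. lborel :: (real^'m) measure" ..
  let ?m = "real CARD('m)" and ?k = "real (card S)"
  let ?K = "student_integral CARD('m)"
  define e where "e = d + ?k"
  define c where "c = (e / (e + 1)) powr (- (?m / 2)) * ?K a"
  have e: "e > 0" using \<open>d > 0\<close> by (simp add: e_def add_pos_nonneg)
  have card: "card (insert i S) = Suc (card S)" using insert.hyps by simp
  \<comment> \<open>the hypothesis on \<open>a\<close> covers the current integral and passes to \<open>a - 1 / 2\<close> for the smaller set\<close>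
  have a: "a > ?m / 2" "a - 1 / 2 > (?m + ?k - 1) / 2"
    using insert.prems by (simp_all add: card field_simps)
  have "c \<ge> 0" using student_integral_nonneg[OF a(1)] by (simp add: c_def)
  have "(\<integral>\<^sup>+x. ennreal (det (B + shrunken_scatter d (insert i S) x) powr (- a)) \<partial>PiM (insert i S) (\<lambda>_. lborel)) =
      (\<integral>\<^sup>+x. \<integral>\<^sup>+y. ennreal (det (B + shrunken_scatter d (insert i S) (x(i := y))) powr (- a)) \<partial>lborel \<partial>PiM S (\<lambda>_. lborel))"
    using insert.hyps by (intro product_nn_integral_insert) measurable
  also have "\<dots> = (\<integral>\<^sup>+x. ennreal c * ennreal (det (B + shrunken_scatter d S x) powr (- (a - 1 / 2))) \<partial>PiM S (\<lambda>_. lborel))"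
  proof (rule nn_integral_cong)
    fix x :: "'i \<Rightarrow> real^'m"
    let ?v = "(1 / e) *\<^sub>R (\<Sum>i\<in>S. x i)"
    have "(\<integral>\<^sup>+y. ennreal (det (B + shrunken_scatter d (insert i S) (x(i := y))) powr (- a)) \<partial>lborel) =
        (\<integral>\<^sup>+y. ennreal (det ((B + shrunken_scatter d S x) + (e / (e + 1)) *\<^sub>R outer (y - ?v) (y - ?v)) powr (- a)) \<partial>lborel)"
      by (simp add: shrunken_scatter_insert[OF insert.hyps \<open>d > 0\<close>] e_def add.assoc)
    also have "\<dots> = ennreal ((e / (e + 1)) powr (- (?m / 2)) * det (B + shrunken_scatter d S x) powr (- (a - 1 / 2)) * ?K a)"
      using e by (intro nn_integral_det_rank_one_update pos_def_add_shrunken_scatter a insert.hyps \<open>pos_def B\<close> \<open>d > 0\<close>) simp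
    also have "\<dots> = ennreal c * ennreal (det (B + shrunken_scatter d S x) powr (- (a - 1 / 2)))"
      using \<open>c \<ge> 0\<close> by (simp add: c_def mult_ac flip: ennreal_mult')
    finally show "(\<integral>\<^sup>+y. ennreal (det (B + shrunken_scatter d (insert i S) (x(i := y))) powr (- a)) \<partial>lborel) =
      ennreal c * ennreal (det (B + shrunken_scatter d S x) powr (- (a - 1 / 2)))" .
  qed
  also have "\<dots> = ennreal c * (\<integral>\<^sup>+x. ennreal (det (B + shrunken_scatter d S x) powr (- (a - 1 / 2))) \<partial>PiM S (\<lambda>_. lborel))"
    by (rule nn_integral_cmult) measurable
  also have "\<dots> = ennreal (c * ((1 + ?k / d) powr (?m / 2) * det B powr (- (a - 1 / 2 - ?k / 2)) *
      (\<Prod>k<card S. ?K (a - 1 / 2 - real k / 2))))"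
    by (simp only: insert.IH[OF a(2)] ennreal_mult'[OF \<open>c \<ge> 0\<close>])
  also have "c * ((1 + ?k / d) powr (?m / 2) * det B powr (- (a - 1 / 2 - ?k / 2)) *
      (\<Prod>k<card S. ?K (a - 1 / 2 - real k / 2))) =
      ((e / (e + 1)) powr (- (?m / 2)) * (1 + ?k / d) powr (?m / 2)) * det B powr (- (a - 1 / 2 - ?k / 2)) *
      (?K a * (\<Prod>k<card S. ?K (a - 1 / 2 - real k / 2)))"
    by (simp add: c_def mult_ac)
  also have "(e / (e + 1)) powr (- (?m / 2)) * (1 + ?k / d) powr (?m / 2) =
      (1 + real (card (insert i S)) / d) powr (?m / 2)"
  proof -
    have "(e / (e + 1)) powr (- (?m / 2)) = ((e + 1) / e) powr (?m / 2)"
      using e by (simp add: powr_minus powr_divide)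
    moreover have "1 + ?k / d = e / d" "1 + real (card (insert i S)) / d = (e + 1) / d"
      using \<open>d > 0\<close> by (simp_all add: card e_def field_simps)
    ultimately show ?thesis
      using e \<open>d > 0\<close> by (simp flip: powr_mult)
  qed
  also have "?K a * (\<Prod>k<card S. ?K (a - 1 / 2 - real k / 2)) = (\<Prod>k<card (insert i S). ?K (a - real k / 2))"
    unfolding card by (subst prod.lessThan_Suc_shift) (simp add: diff_divide_distrib add_divide_distrib algebra_simps)
  also have "a - 1 / 2 - ?k / 2 = a - real (card (insert i S)) / 2"
    by (simp add: card field_simps)
  finally show ?case .
qed

lemma prod_lessThan_add:
  fixes g :: "nat \<Rightarrow> 'a::comm_monoid_mult"
  shows "(\<Prod>i<m + n. g i) = (\<Prod>i<m. g i) * (\<Prod>i<n. g (m + i))"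
  by (induction n) (simp_all add: mult.assoc)

text \<open>
  With \<open>G i = \<Gamma>(z - i/2)\<close> both sides express, up to powers of \<open>\<pi>\<close>, the symmetric quantity
  \<open>(\<Prod>i<m+n. G i) / ((\<Prod>i<m. G i) (\<Prod>i<n. G i))\<close>. On the left the product over \<open>m + n\<close> is divided
  by its first \<open>m\<close> factors, on the right by its first \<open>n\<close>. This converts a product over observations
  into a product over dimensions.
\<close>

lemma prod_student_integral:
  assumes z: "z > (real m + real n - 1) / 2"
  shows "(\<Prod>k<n. student_integral m (z - real k / 2)) =
    pi powr (real m * real n / 2) * (multi_Gamma m (z - real n / 2) / multi_Gamma m z)"
proof -
  define G where "G i = Gamma (z - real i / 2)" for i
  have G: "G i > 0" if "i < m + n" for i
    unfolding G_def using z that by (intro Gamma_real_pos) (simp add: field_simps)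
  have pos: "(\<Prod>k<m. G k) \<noteq> 0" "(\<Prod>k<n. G k) \<noteq> 0"
    using G by (auto simp: prod_zero_iff less_le)
  have "(\<Prod>k<m. G k) * (\<Prod>k<n. G (m + k)) = (\<Prod>k<n. G k) * (\<Prod>k<m. G (n + k))"
    using prod_lessThan_add[of G m n] prod_lessThan_add[of G n m] by (simp add: add.commute)
  then have ratio: "(\<Prod>k<n. G (m + k)) / (\<Prod>k<n. G k) = (\<Prod>k<m. G (n + k)) / (\<Prod>k<m. G k)"
    using pos by (simp add: field_simps)
  have "(\<Prod>k<n. student_integral m (z - real k / 2)) =
      (pi powr (real m / 2)) ^ n * ((\<Prod>k<n. G (m + k)) / (\<Prod>k<n. G k))"
    by (simp add: student_integral_def G_def prod.distrib prod_dividef add_divide_distrib algebra_simps)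
  also have "\<dots> = pi powr (real m * real n / 2) * ((\<Prod>k<m. G (n + k)) / (\<Prod>k<m. G k))"
    by (simp add: ratio powr_power mult_ac)
  also have "(\<Prod>k<m. G (n + k)) / (\<Prod>k<m. G k) = multi_Gamma m (z - real n / 2) / multi_Gamma m z"
    by (simp add: multi_Gamma_def G_def add_divide_distrib algebra_simps)
  finally show ?thesis .
qed

section \<open>The posterior mode of the normal model\<close>

text \<open>
  The prior acts like \<open>d\<close> extra observations at the origin, so the scatter about \<open>\<mu>\<close> splits into the
  scatter about the shrunken mean and a square that vanishes only when \<open>\<mu>\<close> is that mean.
\<close>

lemma scatter_about_point:
  fixes x :: "'i \<Rightarrow> real^'m"
  assumes "finite S" "d > 0"
  defines "e \<equiv> d + real (card S)"
  shows "(\<Sum>i\<in>S. outer (x i - \<mu>) (x i - \<mu>)) + d *\<^sub>R outer \<mu> \<mu> =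
    shrunken_scatter d S x +
    e *\<^sub>R outer (\<mu> - (1 / e) *\<^sub>R (\<Sum>i\<in>S. x i)) (\<mu> - (1 / e) *\<^sub>R (\<Sum>i\<in>S. x i))"
proof -
  have e: "e > 0" using assms(2) by (simp add: e_def add_pos_nonneg)
  define s where "s = (\<Sum>i\<in>S. x i)"
  have "(\<Sum>i\<in>S. outer (x i - \<mu>) (x i - \<mu>)) =
      (\<Sum>i\<in>S. outer (x i) (x i)) - outer s \<mu> - outer \<mu> s + real (card S) *\<^sub>R outer \<mu> \<mu>"
    by (simp add: vec_eq_iff outer_def s_def sum_component algebra_simps sum.distrib sum_subtractf
        sum_distrib_left sum_distrib_right)
  moreover have "e *\<^sub>R outer (\<mu> - (1 / e) *\<^sub>R s) (\<mu> - (1 / e) *\<^sub>R s) =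
      (d + real (card S)) *\<^sub>R outer \<mu> \<mu> - outer s \<mu> - outer \<mu> s + (1 / e) *\<^sub>R outer s s"
    using e by (simp add: e_def[symmetric] outer_def vec_eq_iff divide_simps) (simp add: algebra_simps)
  ultimately show ?thesis
    by (simp add: shrunken_scatter_def e_def[symmetric] s_def[symmetric])
       (simp add: e_def algebra_simps)
qed

lemma cov_est_conv_shrunken_scatter:
  fixes x :: "real^'m^'n"
  assumes "\<nu> > 0"
  shows "(real CARD('n) + \<nu>) *\<^sub>R cov_est \<nu> \<sigma> \<rho> x =
    (\<nu> * \<sigma>\<^sup>2) *\<^sub>R mat 1 + shrunken_scatter (\<rho>\<^sup>2 * \<nu>) UNIV (\<lambda>i. x $ i)"
proof -
  have "real CARD('n) + \<nu> \<noteq> 0" using assms by (simp add: add_nonneg_pos less_imp_neq[THEN not_sym])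
  then show ?thesis
    by (simp add: cov_est_def shrunken_scatter_def outer_sum scaleR_diff_right add.commute)
qed

lemma pos_def_cov_est:
  fixes x :: "real^'m^'n"
  assumes "\<nu> > 0" "\<sigma> > 0" "\<rho>\<^sup>2 > 0"
  shows "pos_def (cov_est \<nu> \<sigma> \<rho> x)"
proof -
  have N: "real CARD('n) + \<nu> > 0" using assms by (simp add: add_nonneg_pos)
  have "cov_est \<nu> \<sigma> \<rho> x =
      (1 / (real CARD('n) + \<nu>)) *\<^sub>R ((\<nu> * \<sigma>\<^sup>2) *\<^sub>R mat 1 + shrunken_scatter (\<rho>\<^sup>2 * \<nu>) UNIV (\<lambda>i. x $ i))"
    using N by (simp add: cov_est_conv_shrunken_scatter[OF assms(1), symmetric])
  also have "pos_def \<dots>"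
    using assms N by (intro pos_def_scaleR pos_def_add_shrunken_scatter pos_def_scaleR_mat_1) auto
  finally show ?thesis .
qed

text \<open>
  Factor \<open>\<Sigma>\<^sup>-\<^sup>1 = R\<^sup>T R\<close>. The matrix \<open>R T R\<^sup>T\<close> has the trace of \<open>\<Sigma>\<^sup>-\<^sup>1 T\<close> and determinant \<open>det T / det \<Sigma>\<close>, so
  the bound is \<open>pos_def_det_le_exp_trace\<close> for it, raised to the power \<open>N/2\<close>.
\<close>

lemma covariance_likelihood_le:
  fixes \<Sigma> T :: "real^'m^'m"
  assumes \<Sigma>: "pos_def \<Sigma>" and T: "pos_def T" and N: "N > 0"
  shows "det \<Sigma> powr (- (N / 2)) * exp (- (N / 2) * trace (matrix_inv \<Sigma> ** T)) \<le>
    det T powr (- (N / 2)) * exp (- (N / 2) * real CARD('m))"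
proof -
  obtain R where R: "matrix_inv \<Sigma> = transpose R ** R" "det R \<noteq> 0"
    using pos_def_inverse_factorization[OF \<Sigma>] by blast
  have pos: "det \<Sigma> > 0" "det T > 0" using \<Sigma> T pos_def_det_pos by auto
  have tr: "trace (R ** T ** transpose R) = trace (matrix_inv \<Sigma> ** T)"
    by (subst trace_mul_sym) (simp add: R(1) matrix_mul_assoc)
  have "det (matrix_inv \<Sigma>) * det \<Sigma> = 1"
    using matrix_inv_inverse(2)[of \<Sigma>] pos by (metis det_I det_mul less_irrefl)
  then have "det (R ** T ** transpose R) = det T / det \<Sigma>"
    using pos by (simp add: R(1) det_mul field_simps)
  then have le: "det T / det \<Sigma> \<le> exp (trace (matrix_inv \<Sigma> ** T) - real CARD('m))"
    using pos_def_det_le_exp_trace[OF pos_def_congruence[OF T R(2)]] tr by simp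
  have "(det T / det \<Sigma>) powr (N / 2) \<le> exp (trace (matrix_inv \<Sigma> ** T) - real CARD('m)) powr (N / 2)"
    using le pos N by (intro powr_mono2) auto
  also have "\<dots> = exp ((N / 2) * trace (matrix_inv \<Sigma> ** T) - (N / 2) * real CARD('m))"
    by (simp add: powr_def algebra_simps)
  finally have "det T powr (N / 2) / det \<Sigma> powr (N / 2) \<le>
      exp ((N / 2) * trace (matrix_inv \<Sigma> ** T)) / exp ((N / 2) * real CARD('m))"
    using pos by (simp add: powr_divide less_imp_le exp_diff)
  moreover have "inverse p * inverse x \<le> inverse q * inverse y"
    if "q / p \<le> x / y" "p > 0" "q > 0" "x > 0" "y > 0" for p q x y :: real
    using that by (simp add: field_simps)
  ultimately have "inverse (det \<Sigma> powr (N / 2)) * inverse (exp ((N / 2) * trace (matrix_inv \<Sigma> ** T))) \<le>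
      inverse (det T powr (N / 2)) * inverse (exp ((N / 2) * real CARD('m)))"
    using pos by simp
  then show ?thesis
    by (simp only: powr_minus exp_minus mult_minus_left)
qed

text \<open>
  Both exponents are traces against \<open>\<Sigma>\<^sup>-\<^sup>1\<close>, so they add up to the trace against one matrix, which
  \<open>scatter_about_point\<close> splits into a part free of \<open>\<mu>\<close> and an outer square. Only the last factor
  depends on \<open>\<mu>\<close>.
\<close>

lemma likelihood_times_luckiness:
  fixes x :: "real^'m^'n" and \<mu> :: "real^'m"
  assumes "\<nu> > 0" "\<rho>\<^sup>2 > 0"
  defines "N \<equiv> real CARD('n) + \<nu>"
  shows "normal_lik x (\<mu>, \<Sigma>) * luckiness \<nu> \<sigma> \<rho> (\<mu>, \<Sigma>) =
    (2 * pi) powr (- (real CARD('m) * N / 2)) *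
    (det \<Sigma> powr (- (N / 2)) * exp (- (N / 2) * trace (matrix_inv \<Sigma> ** cov_est \<nu> \<sigma> \<rho> x))) *
    exp (- ((real CARD('n) + \<rho>\<^sup>2 * \<nu>) / 2) *
      ((\<mu> - mean_est \<nu> \<rho> x) \<bullet> (matrix_inv \<Sigma> *v (\<mu> - mean_est \<nu> \<rho> x))))"
proof -
  let ?V = "matrix_inv \<Sigma>" and ?e = "real CARD('n) + \<rho>\<^sup>2 * \<nu>"
  let ?q = "(\<mu> - mean_est \<nu> \<rho> x) \<bullet> (?V *v (\<mu> - mean_est \<nu> \<rho> x))"
  let ?M = "\<Sum>i\<in>UNIV. outer (x $ i - \<mu>) (x $ i - \<mu>)"
  have mean: "(1 / (\<rho>\<^sup>2 * \<nu> + real CARD('n))) *\<^sub>R (\<Sum>i\<in>UNIV. x $ i) = mean_est \<nu> \<rho> x"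
    by (simp add: mean_est_def add.commute)
  have "?M + \<nu> *\<^sub>R (\<sigma>\<^sup>2 *\<^sub>R mat 1 + \<rho>\<^sup>2 *\<^sub>R outer \<mu> \<mu>) =
      (\<nu> * \<sigma>\<^sup>2) *\<^sub>R mat 1 + (?M + (\<rho>\<^sup>2 * \<nu>) *\<^sub>R outer \<mu> \<mu>)"
    by (simp add: algebra_simps)
  also have "\<dots> = N *\<^sub>R cov_est \<nu> \<sigma> \<rho> x + ?e *\<^sub>R outer (\<mu> - mean_est \<nu> \<rho> x) (\<mu> - mean_est \<nu> \<rho> x)"
    using assms(1,2) scatter_about_point[of "UNIV :: 'n set" "\<rho>\<^sup>2 * \<nu>" "\<lambda>i. x $ i" \<mu>]
    by (simp add: N_def cov_est_conv_shrunken_scatter mean)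
  finally have "trace (?V ** (?M + \<nu> *\<^sub>R (\<sigma>\<^sup>2 *\<^sub>R mat 1 + \<rho>\<^sup>2 *\<^sub>R outer \<mu> \<mu>))) =
      trace (?V ** (N *\<^sub>R cov_est \<nu> \<sigma> \<rho> x + ?e *\<^sub>R outer (\<mu> - mean_est \<nu> \<rho> x) (\<mu> - mean_est \<nu> \<rho> x)))"
    by simp
  then have tr: "(\<Sum>i\<in>UNIV. (x $ i - \<mu>) \<bullet> (?V *v (x $ i - \<mu>))) +
      \<nu> * trace (?V ** (\<sigma>\<^sup>2 *\<^sub>R mat 1 + \<rho>\<^sup>2 *\<^sub>R outer \<mu> \<mu>)) =
      N * trace (?V ** cov_est \<nu> \<sigma> \<rho> x) + ?e * ?q"
    by (simp only: matrix_add_ldistrib[of ?V "?M"] matrix_add_ldistrib[of ?V "N *\<^sub>R cov_est \<nu> \<sigma> \<rho> x"]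
        trace_add matrix_mult_scaleR trace_scaleR trace_mult_sum_outer trace_mult_outer)
  have "- (real CARD('m) * N / 2) = - (real CARD('m) * real CARD('n) / 2) + - (real CARD('m) * \<nu> / 2)"
    "- (N / 2) = - (real CARD('n) / 2) + - (\<nu> / 2)"
    by (simp_all add: N_def field_simps)
  then have powers:
    "(2 * pi) powr (- (real CARD('m) * N / 2)) =
      inverse ((2 * pi) powr (real CARD('m) * real CARD('n) / 2)) * inverse ((2 * pi) powr (real CARD('m) * \<nu> / 2))"
    "det \<Sigma> powr (- (N / 2)) = inverse (det \<Sigma> powr (real CARD('n) / 2)) * inverse (det \<Sigma> powr (\<nu> / 2))"
    by (simp_all only: powr_add powr_minus)
  have exps: "exp (- (1 / 2) * (a + \<nu> * b)) = exp (- (1 / 2) * a) * exp (- (\<nu> / 2) * b)" for a b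
    by (simp add: exp_add[symmetric] algebra_simps)
  have "normal_lik x (\<mu>, \<Sigma>) * luckiness \<nu> \<sigma> \<rho> (\<mu>, \<Sigma>) =
      (2 * pi) powr (- (real CARD('m) * N / 2)) * det \<Sigma> powr (- (N / 2)) *
      exp (- (1 / 2) * ((\<Sum>i\<in>UNIV. (x $ i - \<mu>) \<bullet> (?V *v (x $ i - \<mu>))) +
        \<nu> * trace (?V ** (\<sigma>\<^sup>2 *\<^sub>R mat 1 + \<rho>\<^sup>2 *\<^sub>R outer \<mu> \<mu>))))"
    unfolding powers exps normal_lik_def luckiness_def prod.case
    by (simp only: divide_inverse inverse_mult_distrib mult_1_left mult_ac)
  also have "\<dots> = (2 * pi) powr (- (real CARD('m) * N / 2)) * det \<Sigma> powr (- (N / 2)) *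
      exp (- (N / 2) * trace (?V ** cov_est \<nu> \<sigma> \<rho> x) + - (?e / 2) * ?q)"
  proof -
    have "- (1 / 2) * (N * a + e * b) = - (N / 2) * a + - (e / 2) * b" for a b e :: real
      by (simp add: field_simps)
    then show ?thesis by (simp only: tr)
  qed
  finally show ?thesis by (simp only: exp_add mult.assoc)
qed

lemma max_over_eq_arg_max:
  assumes "is_arg_max g (\<lambda>\<theta>. \<theta> \<in> \<Theta>) \<theta>"
  shows "max_over \<Theta> g = g \<theta>"
  unfolding max_over_def using assms
  by (intro Greatest_equality) (auto simp: is_arg_max_linorder)

text \<open>
  The maximum of likelihood times luckiness. The factor \<open>e\<close> is what remains of the exponential there,
  since the trace of \<open>\<Sigma>\<^sup>-\<^sup>1\<close> against \<open>cov_est\<close> is \<open>m\<close> at \<open>\<Sigma> = cov_est\<close>.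
\<close>

definition map_value :: "real \<Rightarrow> real \<Rightarrow> real \<Rightarrow> real^'m^'n \<Rightarrow> real" where
  "map_value \<nu> \<sigma> \<rho> x =
     (2 * pi * exp 1) powr (- (real CARD('m) * (real CARD('n) + \<nu>) / 2)) *
     det (cov_est \<nu> \<sigma> \<rho> x) powr (- ((real CARD('n) + \<nu>) / 2))"

lemma borel_measurable_map_value [measurable]:
  "(map_value \<nu> \<sigma> \<rho> :: real^'m^'n \<Rightarrow> real) \<in> borel_measurable borel"
proof -
  have "continuous_on UNIV (\<lambda>x :: real^'m^'n. det (cov_est \<nu> \<sigma> \<rho> x))"
    unfolding cov_est_def by (intro continuous_intros)
  then have [measurable]: "(\<lambda>x :: real^'m^'n. det (cov_est \<nu> \<sigma> \<rho> x)) \<in> borel_measurable borel"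
    by (rule borel_measurable_continuous_onI)
  show ?thesis
    unfolding map_value_def by measurable
qed

lemma map_estimate_maximizes:
  fixes x :: "real^'m^'n"
  assumes "\<nu> > 0" "\<sigma> > 0" "\<rho>\<^sup>2 > 0"
  defines "g \<equiv> \<lambda>\<theta>. normal_lik x \<theta> * luckiness \<nu> \<sigma> \<rho> \<theta>"
  shows "g (mean_est \<nu> \<rho> x, cov_est \<nu> \<sigma> \<rho> x) = map_value \<nu> \<sigma> \<rho> x"
    and "is_arg_max g (\<lambda>\<theta>. \<theta> \<in> normal_params) (mean_est \<nu> \<rho> x, cov_est \<nu> \<sigma> \<rho> x)"
proof -
  define N where "N = real CARD('n) + \<nu>"
  let ?T = "cov_est \<nu> \<sigma> \<rho> x" and ?m = "real CARD('m)"
  have N: "N > 0" using assms by (simp add: N_def add_nonneg_pos)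
  have T: "pos_def ?T" using assms by (intro pos_def_cov_est)
  have e: "real CARD('n) + \<rho>\<^sup>2 * \<nu> > 0" using assms by (simp add: add_nonneg_pos)
  \<comment> \<open>at the maximum the exponential contributes only \<open>exp (- m N / 2)\<close>\<close>
  have expN: "(2 * pi) powr (- (?m * N / 2)) * exp (- (N / 2) * ?m) = (2 * pi * exp 1) powr (- (?m * N / 2))"
    by (subst powr_mult) (auto simp: powr_def[of "exp 1"] mult_ac)
  have "trace (matrix_inv ?T ** ?T) = ?m"
    using pos_def_det_pos[OF T] by (simp add: matrix_inv_inverse trace_I)
  then show val: "g (mean_est \<nu> \<rho> x, ?T) = map_value \<nu> \<sigma> \<rho> x"
    using likelihood_times_luckiness[OF assms(1,3), of x "mean_est \<nu> \<rho> x" ?T \<sigma>] expN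
    by (simp add: g_def map_value_def N_def[symmetric] mult_ac)
  show "is_arg_max g (\<lambda>\<theta>. \<theta> \<in> normal_params) (mean_est \<nu> \<rho> x, ?T)"
    unfolding is_arg_max_linorder
  proof (intro conjI allI impI)
    show "(mean_est \<nu> \<rho> x, ?T) \<in> normal_params" using T by (simp add: normal_params_def)
    fix \<theta> :: "(real^'m) \<times> (real^'m^'m)" assume "\<theta> \<in> normal_params"
    then obtain \<mu> \<Sigma> where \<theta>: "\<theta> = (\<mu>, \<Sigma>)" and \<Sigma>: "pos_def \<Sigma>"
      by (cases \<theta>) (auto simp: normal_params_def)
    let ?u = "\<mu> - mean_est \<nu> \<rho> x"
    obtain R where R: "matrix_inv \<Sigma> = transpose R ** R" "det R \<noteq> 0"
      using pos_def_inverse_factorization[OF \<Sigma>] by blast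
    have "?u \<bullet> (matrix_inv \<Sigma> *v ?u) = (R *v ?u) \<bullet> (R *v ?u)"
      by (simp only: R(1) matrix_vector_mul_assoc[symmetric] inner_matrix_vector[of ?u "transpose R"] transpose_transpose)
    then have "?u \<bullet> (matrix_inv \<Sigma> *v ?u) \<ge> 0" by simp
    then have le1: "exp (- ((real CARD('n) + \<rho>\<^sup>2 * \<nu>) / 2) * (?u \<bullet> (matrix_inv \<Sigma> *v ?u))) \<le> 1"
      using e by (simp add: mult_nonpos_nonneg)
    have "g \<theta> = (2 * pi) powr (- (?m * N / 2)) *
        (det \<Sigma> powr (- (N / 2)) * exp (- (N / 2) * trace (matrix_inv \<Sigma> ** ?T))) *
        exp (- ((real CARD('n) + \<rho>\<^sup>2 * \<nu>) / 2) * (?u \<bullet> (matrix_inv \<Sigma> *v ?u)))"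
      unfolding g_def \<theta> N_def by (rule likelihood_times_luckiness[OF assms(1,3)])
    also have "\<dots> \<le> (2 * pi) powr (- (?m * N / 2)) *
        (det ?T powr (- (N / 2)) * exp (- (N / 2) * ?m)) * 1"
      by (intro mult_mono covariance_likelihood_le[OF \<Sigma> T N] le1) auto
    also have "\<dots> = map_value \<nu> \<sigma> \<rho> x"
      using expN by (simp add: map_value_def N_def[symmetric] mult_ac)
    finally show "g \<theta> \<le> g (mean_est \<nu> \<rho> x, ?T)" using val by simp
  qed
qed

section \<open>Capacity and density\<close>

text \<open>
  The maximum is a constant times \<open>det (\<nu> \<sigma>\<^sup>2 I + shrunken scatter)\<close> to the power \<open>-N/2\<close>, so the integral is
  an instance of \<open>nn_integral_det_shrunken_scatter\<close>. The remaining powers of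
  \<open>2\<close>, \<open>\<pi>\<close>, \<open>e\<close>, \<open>N\<close>, \<open>\<nu>\<close> and \<open>\<sigma>\<close> are compared through their logarithms.
\<close>

lemma nn_integral_map_value:
  fixes \<nu> \<sigma> \<rho> :: real
  assumes \<nu>: "\<nu> > real CARD('m) - 1" and "\<sigma> > 0" "\<rho>\<^sup>2 > 0"
  shows "(\<integral>\<^sup>+x. ennreal (map_value \<nu> \<sigma> \<rho> x) \<partial>(lborel :: (real^'m^'n) measure)) =
    ennreal (normal_capacity CARD('m) CARD('n) \<nu> (\<sigma>\<^sup>2) (\<rho>\<^sup>2))"
proof -
  let ?m = "real CARD('m)" and ?n = "real CARD('n)"
  define N where "N = ?n + \<nu>"
  define A where "A = (2 * pi * exp 1) powr (- (?m * N / 2)) * (1 / N ^ CARD('m)) powr (- (N / 2))"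
  let ?B = "(\<nu> * \<sigma>\<^sup>2) *\<^sub>R (mat 1 :: real^'m^'m)"
  let ?h = "\<lambda>x :: 'n \<Rightarrow> real^'m. det (?B + shrunken_scatter (\<rho>\<^sup>2 * \<nu>) UNIV x) powr (- (N / 2))"
  define G where "G = multi_Gamma CARD('m) (\<nu> / 2) / multi_Gamma CARD('m) (N / 2)"
  have "?m \<ge> 1" by (simp add: Suc_leI)
  then have \<nu>0: "\<nu> > 0" using \<nu> by linarith
  have N: "N > 0" using \<nu>0 by (simp add: N_def add_nonneg_pos)
  have d: "\<rho>\<^sup>2 * \<nu> > 0" using \<nu>0 assms(3) by simp
  have B: "pos_def ?B" using \<nu>0 assms(2) by (intro pos_def_scaleR_mat_1) simp
  have A0: "A \<ge> 0" by (simp add: A_def)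
  have eq: "map_value \<nu> \<sigma> \<rho> x = A * ?h (\<lambda>i. x $ i)" for x :: "real^'m^'n"
  proof -
    have pos: "det (?B + shrunken_scatter (\<rho>\<^sup>2 * \<nu>) UNIV (\<lambda>i. x $ i)) > 0"
      by (intro pos_def_det_pos pos_def_add_shrunken_scatter B d) simp
    have "cov_est \<nu> \<sigma> \<rho> x = (1 / N) *\<^sub>R (?B + shrunken_scatter (\<rho>\<^sup>2 * \<nu>) UNIV (\<lambda>i. x $ i))"
      using N by (simp add: cov_est_conv_shrunken_scatter[OF \<nu>0, symmetric] N_def[symmetric])
    then have "det (cov_est \<nu> \<sigma> \<rho> x) =
        (1 / N ^ CARD('m)) * det (?B + shrunken_scatter (\<rho>\<^sup>2 * \<nu>) UNIV (\<lambda>i. x $ i))"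
      by (simp add: det_scaleR power_one_over)
    then show ?thesis
      using pos N by (simp only: map_value_def N_def[symmetric] A_def powr_mult mult.assoc)
  qed
  have "(\<integral>\<^sup>+x. ennreal (map_value \<nu> \<sigma> \<rho> x) \<partial>(lborel :: (real^'m^'n) measure)) =
      (\<integral>\<^sup>+x. ennreal A * ennreal (?h x) \<partial>PiM UNIV (\<lambda>_. lborel))"
    by (subst nn_integral_lborel_vec) (measurable, simp only: eq ennreal_mult'[OF A0] vec_lambda_beta)
  also have "\<dots> = ennreal A * (\<integral>\<^sup>+x. ennreal (?h x) \<partial>PiM UNIV (\<lambda>_. lborel))"
    by (rule nn_integral_cmult) measurable
  also have "(\<integral>\<^sup>+x. ennreal (?h x) \<partial>PiM UNIV (\<lambda>_. lborel)) =
      ennreal ((1 + ?n / (\<rho>\<^sup>2 * \<nu>)) powr (?m / 2) * det ?B powr (- (N / 2 - ?n / 2)) *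
      (\<Prod>k<CARD('n). student_integral CARD('m) (N / 2 - real k / 2)))"
    using \<nu> by (intro nn_integral_det_shrunken_scatter B d) (auto simp: N_def field_simps)
  also have "(\<Prod>k<CARD('n). student_integral CARD('m) (N / 2 - real k / 2)) = pi powr (?m * ?n / 2) * G"
    using \<nu> by (subst prod_student_integral) (auto simp: N_def G_def field_simps)
  also have "N / 2 - ?n / 2 = \<nu> / 2" by (simp add: N_def field_simps)
  also have "det ?B = (\<nu> * \<sigma>\<^sup>2) ^ CARD('m)" by (simp add: det_scaleR)
  finally have "(\<integral>\<^sup>+x. ennreal (map_value \<nu> \<sigma> \<rho> x) \<partial>(lborel :: (real^'m^'n) measure)) =
      ennreal (A * ((1 + ?n / (\<rho>\<^sup>2 * \<nu>)) powr (?m / 2) * ((\<nu> * \<sigma>\<^sup>2) ^ CARD('m)) powr (- (\<nu> / 2)) *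
        (pi powr (?m * ?n / 2) * G)))"
    by (simp only: ennreal_mult'[OF A0])
  also have "A * ((1 + ?n / (\<rho>\<^sup>2 * \<nu>)) powr (?m / 2) * ((\<nu> * \<sigma>\<^sup>2) ^ CARD('m)) powr (- (\<nu> / 2)) *
        (pi powr (?m * ?n / 2) * G)) = normal_capacity CARD('m) CARD('n) \<nu> (\<sigma>\<^sup>2) (\<rho>\<^sup>2)"
  proof -
    define t where "t = 1 + ?n / (\<rho>\<^sup>2 * \<nu>)"
    have t: "t > 0" using d by (simp add: t_def add_pos_nonneg)
    have A: "A = exp (- (?m * N / 2) * (ln 2 + ln pi + 1) + (?m * N / 2) * ln N)"
      using N by (simp add: A_def powr_def ln_mult ln_div ln_realpow exp_add[symmetric] algebra_simps)
    have S: "((\<nu> * \<sigma>\<^sup>2) ^ CARD('m)) powr (- (\<nu> / 2)) = exp (- (?m * \<nu> / 2) * (ln \<nu> + 2 * ln \<sigma>))"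
      using \<nu>0 assms(2) by (simp add: powr_def ln_mult ln_realpow algebra_simps)
    have C: "(N powr N * t / ((2 * exp 1) powr N * (pi * \<nu>) powr \<nu>)) powr (?m / 2) =
        exp ((?m / 2) * (N * ln N + ln t - N * (ln 2 + 1) - \<nu> * (ln pi + ln \<nu>)))"
      using \<nu>0 N t by (simp add: powr_def ln_mult ln_div algebra_simps)
    have lhs: "A * (t powr (?m / 2) * ((\<nu> * \<sigma>\<^sup>2) ^ CARD('m)) powr (- (\<nu> / 2)) * pi powr (?m * ?n / 2)) =
        1 / \<sigma> powr (?m * \<nu>) * (N powr N * t / ((2 * exp 1) powr N * (pi * \<nu>) powr \<nu>)) powr (?m / 2)"
    proof -
      have n: "?n = N - \<nu>" by (simp add: N_def)
      have "A * (t powr (?m / 2) * ((\<nu> * \<sigma>\<^sup>2) ^ CARD('m)) powr (- (\<nu> / 2)) * pi powr (?m * ?n / 2)) =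
        exp ((- (?m * N / 2) * (ln 2 + ln pi + 1) + (?m * N / 2) * ln N) + ((?m / 2) * ln t +
          - (?m * \<nu> / 2) * (ln \<nu> + 2 * ln \<sigma>) + (?m * ?n / 2) * ln pi))"
      proof -
        have "t powr (?m / 2) = exp ((?m / 2) * ln t)" "pi powr (?m * ?n / 2) = exp ((?m * ?n / 2) * ln pi)"
          using t by (simp_all add: powr_def)
        then show ?thesis by (simp only: A S exp_add mult.assoc)
      qed
      also have "\<dots> = exp (- (?m * \<nu>) * ln \<sigma> + (?m / 2) * (N * ln N + ln t - N * (ln 2 + 1) - \<nu> * (ln pi + ln \<nu>)))"
        unfolding n by (simp add: field_simps)
      also have "\<dots> = \<sigma> powr (- (?m * \<nu>)) * (N powr N * t / ((2 * exp 1) powr N * (pi * \<nu>) powr \<nu>)) powr (?m / 2)"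
        unfolding C exp_add using assms(2) by (simp add: powr_def)
      finally show ?thesis by (simp add: powr_minus_divide)
    qed
    have "normal_capacity CARD('m) CARD('n) \<nu> (\<sigma>\<^sup>2) (\<rho>\<^sup>2) =
        1 / \<sigma> powr (?m * \<nu>) * (N powr N * t / ((2 * exp 1) powr N * (pi * \<nu>) powr \<nu>)) powr (?m / 2) * G"
      using assms(2) by (simp add: normal_capacity_def N_def t_def G_def)
    then show ?thesis unfolding lhs[symmetric] t_def[symmetric] by (simp only: mult.assoc)
  qed
  finally show ?thesis .
qed

lemma multi_Gamma_pos: "z > (real m - 1) / 2 \<Longrightarrow> multi_Gamma m z > 0"
  unfolding multi_Gamma_def
  by (intro mult_pos_pos prod_pos ballI Gamma_real_pos) (auto simp: field_simps)

text \<open>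
  The integral of the maximum is computed as an extended nonnegative real, and \<open>ennreal\<close> sends negative
  numbers to \<open>0\<close>; the sign makes the value of the Bochner integral readable from it.
\<close>

lemma normal_capacity_pos:
  assumes "\<nu> > real m - 1" "m > 0" "s > 0" "r > 0"
  shows "normal_capacity m n \<nu> s r > 0"
proof -
  have "real m \<ge> 1" using assms by simp
  then have \<nu>: "\<nu> > 0" using assms(1) by linarith
  have "multi_Gamma m (\<nu> / 2) > 0" "multi_Gamma m ((real n + \<nu>) / 2) > 0"
    using assms(1) by (auto intro!: multi_Gamma_pos simp: field_simps)
  moreover have "1 + real n / (r * \<nu>) > 0" "real n + \<nu> > 0"
    using \<nu> assms(4) by (simp_all add: add_pos_nonneg add_nonneg_pos)
  ultimately show ?thesis
    using \<nu> assms unfolding normal_capacity_def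
    by (intro mult_pos_pos divide_pos_pos) (auto simp: powr_gt_zero)
qed

lemma map_value_div_capacity:
  fixes x :: "real^'m^'n"
  assumes \<nu>: "\<nu> > real CARD('m) - 1" and \<sigma>: "\<sigma> > 0" and \<rho>: "\<rho>\<^sup>2 > 0"
  defines "m \<equiv> CARD('m)" and "n \<equiv> CARD('n)"
  shows "map_value \<nu> \<sigma> \<rho> x / normal_capacity m n \<nu> (\<sigma>\<^sup>2) (\<rho>\<^sup>2) =
    (\<nu> powr \<nu> / (pi ^ n * (real n + \<nu>) powr (real n + \<nu>) * (1 + real n / (\<rho>\<^sup>2 * \<nu>)))) powr (real m / 2) *
    (multi_Gamma m ((real n + \<nu>) / 2) / multi_Gamma m (\<nu> / 2)) *
    (\<sigma> powr (real m * \<nu>) / det (cov_est \<nu> \<sigma> \<rho> x) powr ((real n + \<nu>) / 2))"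
proof -
  define N where "N = real n + \<nu>"
  define t where "t = 1 + real n / (\<rho>\<^sup>2 * \<nu>)"
  define D where "D = det (cov_est \<nu> \<sigma> \<rho> x)"
  have "real m \<ge> 1" by (simp add: m_def Suc_leI)
  then have \<nu>0: "\<nu> > 0" using \<nu> unfolding m_def by linarith
  have N: "N > 0" using \<nu>0 by (simp add: N_def add_nonneg_pos)
  have t: "t > 0" using \<nu>0 \<rho> by (simp add: t_def add_pos_nonneg)
  have G: "multi_Gamma m (\<nu> / 2) > 0" "multi_Gamma m (N / 2) > 0"
    using \<nu> by (auto intro!: multi_Gamma_pos simp: field_simps N_def m_def)
  have D: "D > 0" using pos_def_det_pos[OF pos_def_cov_est[OF \<nu>0 \<sigma> \<rho>]] by (simp add: D_def)
  let ?C = "(N powr N * t / ((2 * exp 1) powr N * (pi * \<nu>) powr \<nu>)) powr (real m / 2)"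
  have C: "?C = exp ((real m / 2) * (N * ln N + ln t - N * (ln 2 + 1) - \<nu> * (ln pi + ln \<nu>)))"
    using \<nu>0 N t by (simp add: powr_def ln_mult ln_div algebra_simps)
  have R: "(\<nu> powr \<nu> / (pi ^ n * N powr N * t)) powr (real m / 2) =
      exp ((real m / 2) * (\<nu> * ln \<nu> - (N - \<nu>) * ln pi - N * ln N - ln t))"
    using \<nu>0 N t by (simp add: powr_def ln_mult ln_div ln_realpow N_def algebra_simps)
  have "(2 * pi * exp 1) powr (- (real m * N / 2)) = exp (- (real m * N / 2) * (ln 2 + ln pi + 1))"
    by (simp add: powr_def ln_mult algebra_simps)
  also have "\<dots> = exp ((real m / 2) * (\<nu> * ln \<nu> - (N - \<nu>) * ln pi - N * ln N - ln t) +
      (real m / 2) * (N * ln N + ln t - N * (ln 2 + 1) - \<nu> * (ln pi + ln \<nu>)))"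
    by (simp add: field_simps)
  finally have key: "(2 * pi * exp 1) powr (- (real m * N / 2)) =
      (\<nu> powr \<nu> / (pi ^ n * N powr N * t)) powr (real m / 2) * ?C"
    by (simp only: C R exp_add)
  have "?C > 0" by (simp add: C)
  have "map_value \<nu> \<sigma> \<rho> x = (2 * pi * exp 1) powr (- (real m * N / 2)) * D powr (- (N / 2))"
    by (simp add: map_value_def m_def n_def N_def D_def)
  moreover have "normal_capacity m n \<nu> (\<sigma>\<^sup>2) (\<rho>\<^sup>2) =
      1 / \<sigma> powr (real m * \<nu>) * ?C * (multi_Gamma m (\<nu> / 2) / multi_Gamma m (N / 2))"
    using \<sigma> by (simp add: normal_capacity_def N_def t_def)
  ultimately show ?thesis
    unfolding N_def[symmetric] t_def[symmetric] D_def[symmetric] key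
    using \<open>?C > 0\<close> G D \<sigma> by (simp only: powr_minus) (simp add: divide_simps)
qed

theorem theorem1:
  fixes \<nu> \<sigma> \<rho> :: real
    and f :: "real^'m^'n \<Rightarrow> (real^'m) \<times> (real^'m^'m) \<Rightarrow> real"
    and w :: "(real^'m) \<times> (real^'m^'m) \<Rightarrow> real"
    and \<mu>' :: "real^'m^'n \<Rightarrow> real^'m"
    and \<Sigma>' :: "real^'m^'n \<Rightarrow> real^'m^'m"
    and m n :: nat
    and C :: real
  assumes "m = CARD('m)" and "n = CARD('n)"
    and "\<nu> > real m - 1" and "\<sigma> > 0" and "\<rho>\<^sup>2 > 0"
    and "f = normal_lik" and "w = luckiness \<nu> \<sigma> \<rho>"
    and "\<mu>' = mean_est \<nu> \<rho>" and "\<Sigma>' = cov_est \<nu> \<sigma> \<rho>"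
    and "C = normal_capacity m n \<nu> (\<sigma>\<^sup>2) (\<rho>\<^sup>2)"
  shows "integrable lborel (\<lambda>x. max_over normal_params (\<lambda>\<theta>. f x \<theta> * w \<theta>)) \<and>
    lnml_capacity f normal_params w = C \<and>
    (\<forall>x. is_arg_max (\<lambda>\<theta>. f x \<theta> * w \<theta>) (\<lambda>\<theta>. \<theta> \<in> normal_params) (\<mu>' x, \<Sigma>' x) \<and>
         lnml_density f normal_params w x = f x (\<mu>' x, \<Sigma>' x) * w (\<mu>' x, \<Sigma>' x) / C \<and>
         lnml_density f normal_params w x =
           (\<nu> powr \<nu> /
            (pi ^ n * (real n + \<nu>) powr (real n + \<nu>) * (1 + real n / (\<rho>\<^sup>2 * \<nu>)))) powr (real m / 2) *
           (multi_Gamma m ((real n + \<nu>) / 2) / multi_Gamma m (\<nu> / 2)) *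
           (\<sigma> powr (real m * \<nu>) / det (\<Sigma>' x) powr ((real n + \<nu>) / 2)))"
proof -
  note [simp] = assms(1,2,6-10)
  have \<nu>: "\<nu> > real CARD('m) - 1" using assms(3) by simp
  have "real CARD('m) \<ge> 1" by (simp add: Suc_leI)
  then have \<nu>0: "\<nu> > 0" using \<nu> by linarith
  note map = map_estimate_maximizes[OF \<nu>0 assms(4,5)]
  have max: "max_over normal_params (\<lambda>\<theta>. f x \<theta> * w \<theta>) = map_value \<nu> \<sigma> \<rho> x" for x
    using max_over_eq_arg_max[OF map(2)[of x]] map(1)[of x] by simp
  have C: "C > 0" using normal_capacity_pos[OF \<nu>, of "\<sigma>\<^sup>2" "\<rho>\<^sup>2"] assms(4,5) by simp
  have nonneg: "map_value \<nu> \<sigma> \<rho> x \<ge> 0" for x :: "real^'m^'n" by (simp add: map_value_def)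
  have int: "(\<integral>\<^sup>+x. ennreal (map_value \<nu> \<sigma> \<rho> x) \<partial>(lborel :: (real^'m^'n) measure)) = ennreal C"
    using nn_integral_map_value[OF \<nu> assms(4,5)] by simp
  have bochner: "has_bochner_integral lborel (\<lambda>x :: real^'m^'n. map_value \<nu> \<sigma> \<rho> x) C"
    using nonneg int C by (intro has_bochner_integral_nn_integral) auto
  have cap: "lnml_capacity f normal_params w = C"
    unfolding lnml_capacity_def max by (rule has_bochner_integral_integral_eq[OF bochner])
  have "integrable lborel (\<lambda>x. max_over normal_params (\<lambda>\<theta>. f x \<theta> * w \<theta>))"
    unfolding max using bochner by (rule integrable.intros)
  moreover have "is_arg_max (\<lambda>\<theta>. f x \<theta> * w \<theta>) (\<lambda>\<theta>. \<theta> \<in> normal_params) (\<mu>' x, \<Sigma>' x)" for x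
    using map(2)[of x] by simp
  moreover have "lnml_density f normal_params w x = f x (\<mu>' x, \<Sigma>' x) * w (\<mu>' x, \<Sigma>' x) / C" for x
    unfolding lnml_density_def cap max using map(1)[of x] by simp
  moreover have "lnml_density f normal_params w x = map_value \<nu> \<sigma> \<rho> x / C" for x
    unfolding lnml_density_def cap max ..
  then have "lnml_density f normal_params w x =
      (\<nu> powr \<nu> /
       (pi ^ n * (real n + \<nu>) powr (real n + \<nu>) * (1 + real n / (\<rho>\<^sup>2 * \<nu>)))) powr (real m / 2) *
      (multi_Gamma m ((real n + \<nu>) / 2) / multi_Gamma m (\<nu> / 2)) *
      (\<sigma> powr (real m * \<nu>) / det (\<Sigma>' x) powr ((real n + \<nu>) / 2))" for x
    using map_value_div_capacity[OF \<nu> assms(4,5), of x] by (simp only: assms(1,2,9,10))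
  ultimately show ?thesis
    using cap by blast
qed

end
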